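(* The provability problem for $\mathsf{HOMSL}(\omega)$ reduces to the provability problem for $\mathsf{MSL}(\omega)$: there is a computable function mapping every instance $(\Sigma,\Pi,D,G)$ of $\mathsf{HOMSL}(\omega)$ provability to an instance $(\Sigma',\Pi',D',G')$ of $\mathsf{MSL}(\omega)$ provability such that $D\vdash G$ if and only if $D'\vdash G'$.
   Context: **Types.** Constructor types: $\gamma ::= \iota \mid \gamma \to \gamma$. Predicate types: $\rho ::= o \mid \sigma \to \rho$, where argument types are $\sigma ::= \gamma \mid \rho$. **Syntax.** $\Sigma$ is a finite set of function symbols $c:\gamma$, $\Pi$ a finite set of predicate symbols $P:\rho$. Terms are simply typed applicative terms built from typed variables, symbols of $\Sigma$ and symbols of $\Pi$ (no $\lambda$-abstraction). Atomic formulas $A$ are terms of type $o$. Goal formulas: $G ::= A \mid G \wedge G \mid \exists x{:}\sigma.\,G \mid \mathsf{true}$. Definite formulas are finite conjunctions (possibly $\mathsf{true}$) of definite clauses of the forms $\forall \overline{y{:}\sigma}.\,G \Rightarrow P\,\overline{y}$ and $\forall \overline{y{:}\sigma}.\,G \Rightarrow P\,(c\,\overline{y})$, where $P\in\Pi$, $c\in\Sigma$, the variables $\overline y$ are pairwise distinct, $G$ is a goal formula, everything is well typed, and in the second form $P:\iota\to o$. Formulas are identified up to renaming of bound variables and associativity and commutativity of $\wedge$ with unit $\mathsf{true}$; a definite formula is also viewed as its set of clauses. All instances consist of closed formulas. **Proof system.** $D \vdash G$ is defined inductively: $D \vdash \mathsf{true}$; if $D\vdash G$ and $D \vdash H$ then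 $D \vdash G\wedge H$; if $D \vdash G[t/x]$ for some closed term $t$ of the type of $x$ then $D \vdash \exists x.\,G$; if $(\forall\overline y.\,G\Rightarrow A)\in D$ and $D \vdash G[\overline s/\overline y]$ for closed terms $\overline s$ of the types of $\overline y$, then $D \vdash A[\overline s/\overline y]$. **Fragments and problem.** $\mathsf{HOMSL}(\omega)$ is the full language just described. $\mathsf{MSL}(\omega)$ is the restriction in which every predicate symbol has type $\iota\to o$ and all quantified variables have constructor types (function symbols may still have arbitrary constructor types). The provability problem of a fragment is: given finite signatures $\Sigma,\Pi$, a definite formula $D$ and a goal formula $G$ of the fragment, decide whether $D\vdash G$. *)

theory Defs
  imports Main "HOL-Library.Nat_Bijection" "HOL-Library.Multiset"
begin

section \<open>Types\<close>

text \<open>All types live in one datatype of simple types; the grammars for constructor types,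
  predicate types and argument types are carved out as predicates.\<close>

datatype ty = Iota | Prop | Fun ty ty

fun constr_ty :: "ty \<Rightarrow> bool" where
  "constr_ty Iota = True"
| "constr_ty Prop = False"
| "constr_ty (Fun a b) = (constr_ty a \<and> constr_ty b)"

fun pred_ty :: "ty \<Rightarrow> bool" where
  "pred_ty Iota = False"
| "pred_ty Prop = True"
| "pred_ty (Fun a b) = ((constr_ty a \<or> pred_ty a) \<and> pred_ty b)"

definition arg_ty :: "ty \<Rightarrow> bool" where
  "arg_ty s \<longleftrightarrow> constr_ty s \<or> pred_ty s"


section \<open>Terms, goal formulas and clauses\<close>

text \<open>Finite signatures are lists of types: the symbols are the positions of the list and the
  entry at a position is the type of that symbol.  Variables are de Bruijn indices, so
  formulas that differ only in the names of bound variables are equal.  In a typing context, the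
  type of variable \<open>i\<close> is the \<open>i\<close>-th entry.\<close>

datatype tm = Var nat | Fn nat | Pred nat | App tm tm

definition apps :: "tm \<Rightarrow> tm list \<Rightarrow> tm" where
  "apps t ts = foldl App t ts"

inductive has_ty :: "ty list \<Rightarrow> ty list \<Rightarrow> ty list \<Rightarrow> tm \<Rightarrow> ty \<Rightarrow> bool"
  for Fs Ps \<Gamma> where
  "i < length \<Gamma> \<Longrightarrow> has_ty Fs Ps \<Gamma> (Var i) (\<Gamma> ! i)"
| "c < length Fs \<Longrightarrow> has_ty Fs Ps \<Gamma> (Fn c) (Fs ! c)"
| "P < length Ps \<Longrightarrow> has_ty Fs Ps \<Gamma> (Pred P) (Ps ! P)"
| "has_ty Fs Ps \<Gamma> s (Fun a b) \<Longrightarrow> has_ty Fs Ps \<Gamma> t a \<Longrightarrow> has_ty Fs Ps \<Gamma> (App s t) b"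

datatype goal = Atom tm | Conj goal goal | Ex ty goal | Truth

text \<open>\<open>Clause \<sigma>s G A\<close> stands for \<open>\<forall>y\<^sub>0:\<sigma>\<^sub>0 \<dots> y\<^sub>n:\<sigma>\<^sub>n. G \<Rightarrow> A\<close>, where \<open>y\<^sub>i\<close> is \<open>Var i\<close> in \<open>A\<close> and
  at the top level of \<open>G\<close>.  A definite formula is a list of clauses, read as their conjunction.\<close>

datatype clause = Clause "ty list" goal tm

primrec wf_goal :: "ty list \<Rightarrow> ty list \<Rightarrow> ty list \<Rightarrow> goal \<Rightarrow> bool" where
  "wf_goal Fs Ps \<Gamma> (Atom A) = has_ty Fs Ps \<Gamma> A Prop"
| "wf_goal Fs Ps \<Gamma> (Conj G H) = (wf_goal Fs Ps \<Gamma> G \<and> wf_goal Fs Ps \<Gamma> H)"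
| "wf_goal Fs Ps \<Gamma> (Ex s G) = (arg_ty s \<and> wf_goal Fs Ps (s # \<Gamma>) G)"
| "wf_goal Fs Ps \<Gamma> Truth = True"

fun wf_clause :: "ty list \<Rightarrow> ty list \<Rightarrow> clause \<Rightarrow> bool" where
  "wf_clause Fs Ps (Clause ss G A) =
    (list_all arg_ty ss \<and> wf_goal Fs Ps ss G \<and> has_ty Fs Ps ss A Prop \<and>
      (let ys = map Var [0..<length ss] in
        (\<exists>P. A = apps (Pred P) ys) \<or>
        (\<exists>P c. Ps ! P = Fun Iota Prop \<and> A = App (Pred P) (apps (Fn c) ys))))"


section \<open>Provability\<close>

text \<open>Simultaneous substitution of the terms \<open>ts\<close> for the variables \<open>k, \<dots>, k + length ts - 1\<close>.
  The terms are always closed below, so they need no lifting under binders.\<close>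

primrec subst_tm :: "nat \<Rightarrow> tm list \<Rightarrow> tm \<Rightarrow> tm" where
  "subst_tm k ts (Var i) =
    (if i < k then Var i else if i < k + length ts then ts ! (i - k) else Var (i - length ts))"
| "subst_tm k ts (Fn c) = Fn c"
| "subst_tm k ts (Pred P) = Pred P"
| "subst_tm k ts (App s t) = App (subst_tm k ts s) (subst_tm k ts t)"

primrec subst_goal :: "nat \<Rightarrow> tm list \<Rightarrow> goal \<Rightarrow> goal" where
  "subst_goal k ts (Atom A) = Atom (subst_tm k ts A)"
| "subst_goal k ts (Conj G H) = Conj (subst_goal k ts G) (subst_goal k ts H)"
| "subst_goal k ts (Ex s G) = Ex s (subst_goal (Suc k) ts G)"
| "subst_goal k ts Truth = Truth"

inductive proves :: "ty list \<Rightarrow> ty list \<Rightarrow> clause list \<Rightarrow> goal \<Rightarrow> bool"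
  for Fs Ps D where
  "proves Fs Ps D Truth"
| "proves Fs Ps D G \<Longrightarrow> proves Fs Ps D H \<Longrightarrow> proves Fs Ps D (Conj G H)"
| "has_ty Fs Ps [] t s \<Longrightarrow> proves Fs Ps D (subst_goal 0 [t] G) \<Longrightarrow> proves Fs Ps D (Ex s G)"
| "Clause ss G A \<in> set D \<Longrightarrow> list_all2 (has_ty Fs Ps []) ts ss \<Longrightarrow>
    proves Fs Ps D (subst_goal 0 ts G) \<Longrightarrow> proves Fs Ps D (Atom (subst_tm 0 ts A))"


section \<open>Instances of the two fragments\<close>

datatype problem = Problem "ty list" "ty list" "clause list" goal

fun provable :: "problem \<Rightarrow> bool" where
  "provable (Problem Fs Ps D G) = proves Fs Ps D G"

fun homsl_instance :: "problem \<Rightarrow> bool" where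
  "homsl_instance (Problem Fs Ps D G) =
    (list_all constr_ty Fs \<and> list_all pred_ty Ps \<and>
     list_all (wf_clause Fs Ps) D \<and> wf_goal Fs Ps [] G)"

primrec constr_quants :: "goal \<Rightarrow> bool" where
  "constr_quants (Atom A) = True"
| "constr_quants (Conj G H) = (constr_quants G \<and> constr_quants H)"
| "constr_quants (Ex s G) = (constr_ty s \<and> constr_quants G)"
| "constr_quants Truth = True"

fun constr_quants_clause :: "clause \<Rightarrow> bool" where
  "constr_quants_clause (Clause ss G A) = (list_all constr_ty ss \<and> constr_quants G)"

fun msl_instance :: "problem \<Rightarrow> bool" where
  "msl_instance (Problem Fs Ps D G) =
    (homsl_instance (Problem Fs Ps D G) \<and>
     list_all (\<lambda>r. r = Fun Iota Prop) Ps \<and>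
     list_all constr_quants_clause D \<and> constr_quants G)"


section \<open>Identification of formulas\<close>

text \<open>Formulas are identified up to associativity and commutativity of conjunction with unit
  \<open>Truth\<close>.  Provability does not depend on the representative, but a map on instances has to be
  well defined on the classes.\<close>

inductive goal_eq :: "goal \<Rightarrow> goal \<Rightarrow> bool" where
  "goal_eq G G"
| "goal_eq G H \<Longrightarrow> goal_eq H G"
| "goal_eq G H \<Longrightarrow> goal_eq H K \<Longrightarrow> goal_eq G K"
| "goal_eq G G' \<Longrightarrow> goal_eq H H' \<Longrightarrow> goal_eq (Conj G H) (Conj G' H')"
| "goal_eq G G' \<Longrightarrow> goal_eq (Ex s G) (Ex s G')"
| "goal_eq (Conj (Conj G H) K) (Conj G (Conj H K))"
| "goal_eq (Conj G H) (Conj H G)"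
| "goal_eq (Conj Truth G) G"

fun clause_eq :: "clause \<Rightarrow> clause \<Rightarrow> bool" where
  "clause_eq (Clause ss G A) (Clause ss' G' A') = (ss = ss' \<and> goal_eq G G' \<and> A = A')"

fun problem_eq :: "problem \<Rightarrow> problem \<Rightarrow> bool" where
  "problem_eq (Problem Fs Ps D G) (Problem Fs' Ps' D' G') =
    (Fs = Fs' \<and> Ps = Ps' \<and> rel_mset clause_eq (mset D) (mset D') \<and> goal_eq G G')"


section \<open>Computability\<close>

text \<open>Kleene's partial recursive functions on tuples of natural numbers; \<open>None\<close> means undefined.
  Recursion and search both act on the first argument.\<close>

datatype recf = Z | S | Id nat | Cn recf "recf list" | Pr recf recf | Mn recf

primrec rec_val :: "recf \<Rightarrow> nat list \<Rightarrow> nat option" where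
  "rec_val Z xs = Some 0"
| "rec_val S xs = (case xs of [x] \<Rightarrow> Some (Suc x) | _ \<Rightarrow> None)"
| "rec_val (Id i) xs = (if i < length xs then Some (xs ! i) else None)"
| "rec_val (Cn f gs) xs = Option.bind (those (map (\<lambda>g. rec_val g xs) gs)) (rec_val f)"
| "rec_val (Pr f g) xs =
    (case xs of [] \<Rightarrow> None
     | n # ys \<Rightarrow> rec_nat (rec_val f ys)
         (\<lambda>m r. Option.bind r (\<lambda>v. rec_val g (m # v # ys))) n)"
| "rec_val (Mn f) xs =
    (if \<exists>n. rec_val f (n # xs) = Some 0 \<and> (\<forall>m<n. rec_val f (m # xs) \<noteq> None)
     then Some (LEAST n. rec_val f (n # xs) = Some 0) else None)"

text \<open>Instances are coded as numbers by nesting the library's list coding: a constructor becomes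
  the list of its tag and its coded arguments.\<close>

primrec code_ty :: "ty \<Rightarrow> nat" where
  "code_ty Iota = list_encode [0]"
| "code_ty Prop = list_encode [1]"
| "code_ty (Fun a b) = list_encode [2, code_ty a, code_ty b]"

primrec code_tm :: "tm \<Rightarrow> nat" where
  "code_tm (Var i) = list_encode [0, i]"
| "code_tm (Fn c) = list_encode [1, c]"
| "code_tm (Pred P) = list_encode [2, P]"
| "code_tm (App s t) = list_encode [3, code_tm s, code_tm t]"

primrec code_goal :: "goal \<Rightarrow> nat" where
  "code_goal (Atom A) = list_encode [0, code_tm A]"
| "code_goal (Conj G H) = list_encode [1, code_goal G, code_goal H]"
| "code_goal (Ex s G) = list_encode [2, code_ty s, code_goal G]"
| "code_goal Truth = list_encode [3]"

fun code_clause :: "clause \<Rightarrow> nat" where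
  "code_clause (Clause ss G A) =
    list_encode [list_encode (map code_ty ss), code_goal G, code_tm A]"

fun code_problem :: "problem \<Rightarrow> nat" where
  "code_problem (Problem Fs Ps D G) =
    list_encode [list_encode (map code_ty Fs), list_encode (map code_ty Ps),
      list_encode (map code_clause D), code_goal G]"

definition computable_on :: "problem set \<Rightarrow> (problem \<Rightarrow> problem) \<Rightarrow> bool" where
  "computable_on X f \<longleftrightarrow>
    (\<exists>r. \<forall>I\<in>X. rec_val r [code_problem I] = Some (code_problem (f I)))"

lemma code_ty_inject: "code_ty a = code_ty b \<longleftrightarrow> a = b"
proof (induction a arbitrary: b)
  case Iota show ?case by (cases b) (simp_all del: list_encode.simps add: list_encode_eq)
next
  case Prop show ?case by (cases b) (simp_all del: list_encode.simps add: list_encode_eq)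
next
  case (Fun a1 a2) then show ?case
    by (cases b) (simp_all del: list_encode.simps add: list_encode_eq)
qed

lemma code_tm_inject: "code_tm a = code_tm b \<longleftrightarrow> a = b"
proof (induction a arbitrary: b)
  case (Var i) show ?case by (cases b) (simp_all del: list_encode.simps add: list_encode_eq)
next
  case (Fn i) show ?case by (cases b) (simp_all del: list_encode.simps add: list_encode_eq)
next
  case (Pred i) show ?case by (cases b) (simp_all del: list_encode.simps add: list_encode_eq)
next
  case (App a1 a2) then show ?case
    by (cases b) (simp_all del: list_encode.simps add: list_encode_eq)
qed

lemma code_goal_inject: "code_goal a = code_goal b \<longleftrightarrow> a = b"
proof (induction a arbitrary: b)
  case (Atom i) show ?case
    by (cases b) (simp_all del: list_encode.simps add: list_encode_eq code_tm_inject)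
next
  case (Conj a1 a2) then show ?case
    by (cases b) (simp_all del: list_encode.simps add: list_encode_eq)
next
  case (Ex s a) then show ?case
    by (cases b) (simp_all del: list_encode.simps add: list_encode_eq code_ty_inject)
next
  case Truth show ?case by (cases b) (simp_all del: list_encode.simps add: list_encode_eq)
qed

lemma code_clause_inject: "code_clause a = code_clause b \<longleftrightarrow> a = b"
  by (cases a; cases b)
    (simp del: list_encode.simps add: list_encode_eq code_goal_inject code_tm_inject
      inj_map_eq_map inj_def code_ty_inject)

lemma code_problem_inject: "code_problem I = code_problem J \<longleftrightarrow> I = J"
  by (cases I; cases J)
    (simp del: list_encode.simps add: list_encode_eq code_goal_inject code_clause_inject
      inj_map_eq_map inj_def code_ty_inject)

end

theory Submission
  imports Defs
begin

text \<open>Every predicate symbol becomes a function symbol, so that a closed atom \<open>A\<close> becomes a term, and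
  a single monadic predicate expresses truth.  The base types are encoded as
  \<open>\<iota> \<mapsto> \<iota> \<rightarrow> \<iota>\<close> and \<open>o \<mapsto> \<tau> \<rightarrow> \<iota>\<close>, where \<open>\<tau> = (\<iota> \<rightarrow> \<iota> \<rightarrow> \<iota>) \<rightarrow> \<iota>\<close>; the new arguments are filled
  with new constants of types \<open>\<iota>\<close> and \<open>\<tau>\<close>.  Translating \<open>o\<close> and \<open>\<iota>\<close> both to \<open>\<iota>\<close> would be unsound,
  since quantifiers could then be instantiated with ill-sorted terms.  Here the type translation is injective,
  neither \<open>\<iota>\<close> nor \<open>\<tau>\<close> nor the argument type of \<open>\<tau>\<close> is an encoded type, and the latter is
  uninhabited.  Hence the closed terms of an encoded type are exactly the encoded closed terms,
  and derivations can be translated in both directions.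

  A head \<open>P (c y)\<close> would become the non-shallow \<open>T (P' (c' y) z)\<close>.  Instead the monadic
  predicates \<open>P\<close> are kept, the clause gets the head \<open>P (c' y z)\<close>, and a clause
  \<open>P (x k) \<Rightarrow> T (P' x z)\<close> connects the two copies of \<open>P\<close>.\<close>

section \<open>The encoding\<close>

definition tok_ty :: ty where
  "tok_ty = Fun (Fun Iota (Fun Iota Iota)) Iota"

primrec enc_ty :: "ty \<Rightarrow> ty" where
  "enc_ty Iota = Fun Iota Iota"
| "enc_ty Prop = Fun tok_ty Iota"
| "enc_ty (Fun a b) = Fun (enc_ty a) (enc_ty b)"

text \<open>In the encoded signature, \<open>Fn 0\<close> and \<open>Fn 1\<close> are the constants of types \<open>Iota\<close> and \<open>tok_ty\<close>,
  and \<open>n\<close> is the position of the first former predicate symbol.  \<open>Pred 0\<close> is the truth predicate,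
  and \<open>Pred (Suc P)\<close> the monadic copy of \<open>P\<close>, without clauses unless some clause has a head
  \<open>P (c y)\<close>.\<close>

primrec enc_tm :: "nat \<Rightarrow> tm \<Rightarrow> tm" where
  "enc_tm n (Var i) = Var i"
| "enc_tm n (Fn c) = Fn (c + 2)"
| "enc_tm n (Pred P) = Fn (P + n)"
| "enc_tm n (App s t) = App (enc_tm n s) (enc_tm n t)"

primrec enc_goal :: "nat \<Rightarrow> goal \<Rightarrow> goal" where
  "enc_goal n (Atom A) = Atom (App (Pred 0) (App (enc_tm n A) (Fn 1)))"
| "enc_goal n (Conj G H) = Conj (enc_goal n G) (enc_goal n H)"
| "enc_goal n (Ex s G) = Ex (enc_ty s) (enc_goal n G)"
| "enc_goal n Truth = Truth"

definition truth_clause :: "nat \<Rightarrow> ty list \<Rightarrow> goal \<Rightarrow> tm \<Rightarrow> clause" where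
  "truth_clause n ss G A = Clause (map enc_ty ss @ [tok_ty]) (enc_goal n G)
     (App (Pred 0) (App (enc_tm n A) (Var (length ss))))"

definition constr_clause :: "nat \<Rightarrow> ty list \<Rightarrow> goal \<Rightarrow> nat \<Rightarrow> tm \<Rightarrow> clause" where
  "constr_clause n ss G P X = Clause (map enc_ty ss @ [Iota]) (enc_goal n G)
     (App (Pred (Suc P)) (App (enc_tm n X) (Var (length ss))))"

definition bridge_clause :: "nat \<Rightarrow> nat \<Rightarrow> clause" where
  "bridge_clause n P = Clause [Fun Iota Iota, tok_ty]
     (Atom (App (Pred (Suc P)) (App (Var 0) (Fn 0))))
     (App (Pred 0) (App (App (Fn (P + n)) (Var 0)) (Var 1)))"

text \<open>In a well-formed clause, a non-variable argument of a head \<open>App (Pred P) X\<close>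
  must have the form \<open>c y\<close>, so matching on syntax separates the two clause forms. A
  constant \<open>c\<close> without arguments is covered as well.\<close>

fun enc_clause :: "nat \<Rightarrow> clause \<Rightarrow> clause list" where
  "enc_clause n (Clause ss G A) =
    (case A of
       App (Pred P) X \<Rightarrow>
         (case X of Var i \<Rightarrow> [truth_clause n ss G A]
          | _ \<Rightarrow> [constr_clause n ss G P X, bridge_clause n P])
     | _ \<Rightarrow> [truth_clause n ss G A])"

definition enc_fns :: "ty list \<Rightarrow> ty list \<Rightarrow> ty list" where
  "enc_fns Fs Ps = Iota # tok_ty # map enc_ty Fs @ map enc_ty Ps"

definition enc_preds :: "ty list \<Rightarrow> ty list" where
  "enc_preds Ps = Fun Iota Prop # map (\<lambda>_. Fun Iota Prop) Ps"

fun enc_problem :: "problem \<Rightarrow> problem" where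
  "enc_problem (Problem Fs Ps D G) =
    Problem (enc_fns Fs Ps) (enc_preds Ps)
      (concat (map (enc_clause (length Fs + 2)) D)) (enc_goal (length Fs + 2) G)"

section \<open>Typing and substitution\<close>

inductive_cases has_ty_FnE: "has_ty Fs Ps \<Gamma> (Fn i) a"
inductive_cases has_ty_PredE: "has_ty Fs Ps \<Gamma> (Pred i) a"
inductive_cases has_ty_AppE: "has_ty Fs Ps \<Gamma> (App s t) a"

lemma has_ty_Var: "i < length \<Gamma> \<Longrightarrow> \<Gamma> ! i = a \<Longrightarrow> has_ty Fs Ps \<Gamma> (Var i) a"
  and has_ty_Fn: "c < length Fs \<Longrightarrow> Fs ! c = a \<Longrightarrow> has_ty Fs Ps \<Gamma> (Fn c) a"
  and has_ty_Pred: "P < length Ps \<Longrightarrow> Ps ! P = a \<Longrightarrow> has_ty Fs Ps \<Gamma> (Pred P) a"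
  by (auto intro: has_ty.intros)

lemma apps_Nil [simp]: "apps t [] = t"
  and apps_snoc [simp]: "apps t (ts @ [u]) = App (apps t ts) u"
  by (simp_all add: apps_def)

lemma enc_tm_apps: "enc_tm n (apps t ts) = apps (enc_tm n t) (map (enc_tm n) ts)"
  by (induction ts rule: rev_induct) simp_all

text \<open>The dummy is the variable right after the clause's own variables, so the encoded term
  applies one symbol to all bound variables in order, as \<open>wf_clause\<close> demands.\<close>

lemma enc_tm_apps_Var:
  "App (enc_tm n (apps t (map Var [0..<k]))) (Var k) = apps (enc_tm n t) (map Var [0..<Suc k])"
  by (simp add: enc_tm_apps comp_def)

section \<open>Separation of the encoded types\<close>

lemma constr_ty_enc_ty [simp]: "constr_ty (enc_ty a)"
  by (induction a) (simp_all add: tok_ty_def)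

lemma enc_ty_neq_Iota [simp]: "enc_ty a \<noteq> Iota" "Iota \<noteq> enc_ty a"
  by (cases a; simp)+

text \<open>An encoded arrow type has a codomain other than \<open>Iota\<close>, whereas both
  encoded base types have codomain \<open>Iota\<close> and differ in their domains.\<close>

lemma enc_ty_inject [simp]: "enc_ty a = enc_ty b \<longleftrightarrow> a = b"
proof (induction a arbitrary: b)
  case Iota then show ?case by (cases b) (auto simp: tok_ty_def)
next
  case Prop then show ?case by (cases b) (auto simp: tok_ty_def)
next
  case (Fun a1 a2) then show ?case by (cases b) auto
qed

lemma enc_ty_neq_tok [simp]: "enc_ty a \<noteq> tok_ty"
  by (cases a) (auto simp: tok_ty_def)

lemma enc_ty_not_prop [simp]: "enc_ty a \<noteq> Prop" "enc_ty a \<noteq> Fun b Prop"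
proof -
  show "enc_ty a \<noteq> Prop" for a by (cases a) simp_all
  then show "enc_ty a \<noteq> Fun b Prop" by (cases a) auto
qed

text \<open>Serves to exclude closed terms that apply something of type \<open>tok_ty\<close> to an
  argument.\<close>

lemma enc_ty_neq_tok_arg: "enc_ty a \<noteq> Fun Iota (Fun Iota Iota)"
  by (cases a) (auto simp: tok_ty_def)

section \<open>Weakening and substitution\<close>

lemma has_ty_append: "has_ty Fs Ps \<Gamma> t a \<Longrightarrow> has_ty Fs Ps (\<Gamma> @ \<Delta>) t a"
proof (induction rule: has_ty.induct)
  case (1 i) then show ?case by (intro has_ty_Var) (simp_all add: nth_append)
qed (auto intro: has_ty.intros)

lemma has_ty_closed: "has_ty Fs Ps [] t a \<Longrightarrow> has_ty Fs Ps \<Gamma> t a"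
  using has_ty_append[of Fs Ps "[]" t a \<Gamma>] by simp

lemma has_ty_subst:
  assumes "has_ty Fs Ps (\<Delta> @ ss) t a" "list_all2 (has_ty Fs Ps []) ts ss"
  shows "has_ty Fs Ps \<Delta> (subst_tm (length \<Delta>) ts t) a"
  using assms
proof (induction rule: has_ty.induct)
  case (1 i)
  show ?case
  proof (cases "i < length \<Delta>")
    case True then show ?thesis by (auto intro!: has_ty_Var simp: nth_append)
  next
    case False
    with 1 have "has_ty Fs Ps [] (ts ! (i - length \<Delta>)) (ss ! (i - length \<Delta>))"
      by (auto simp: list_all2_conv_all_nth)
    with 1 False show ?thesis
      by (auto simp: nth_append list_all2_lengthD intro: has_ty_closed)
  qed
qed (auto intro: has_ty.intros)

lemma wf_goal_subst:
  assumes "wf_goal Fs Ps (\<Delta> @ ss) G" "list_all2 (has_ty Fs Ps []) ts ss"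
  shows "wf_goal Fs Ps \<Delta> (subst_goal (length \<Delta>) ts G)"
  using assms
proof (induction G arbitrary: \<Delta>)
  case (Ex s G)
  then show ?case using Ex.IH[of "s # \<Delta>"] by simp
qed (auto intro: has_ty_subst)

text \<open>All variables of \<open>t\<close> lie below \<open>k + length ts\<close>, so the terms
  \<open>us\<close> are never reached. This removes the dummy instance wherever the dummy variable
  does not occur.\<close>

lemma subst_tm_append:
  assumes "has_ty Fs Ps \<Gamma> t a" "length \<Gamma> \<le> k + length ts"
  shows "subst_tm k (ts @ us) t = subst_tm k ts t"
  using assms by (induction rule: has_ty.induct) (auto simp: nth_append)

lemma subst_goal_append:
  assumes "wf_goal Fs Ps \<Gamma> G" "length \<Gamma> \<le> k + length ts"
  shows "subst_goal k (ts @ us) G = subst_goal k ts G"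
  using assms
proof (induction G arbitrary: \<Gamma> k)
  case (Ex s G) then show ?case using Ex.IH[of "s # \<Gamma>" "Suc k"] by simp
next
  case (Conj G H) then show ?case by auto
qed (auto simp: subst_tm_append)

lemma enc_tm_subst: "enc_tm n (subst_tm k ts t) = subst_tm k (map (enc_tm n) ts) (enc_tm n t)"
  by (induction t) auto

lemma enc_goal_subst:
  "enc_goal n (subst_goal k ts G) = subst_goal k (map (enc_tm n) ts) (enc_goal n G)"
  by (induction G arbitrary: k) (auto simp: enc_tm_subst)

lemma wf_goal_append: "wf_goal Fs Ps \<Gamma> G \<Longrightarrow> wf_goal Fs Ps (\<Gamma> @ \<Delta>) G"
proof (induction G arbitrary: \<Gamma>)
  case (Ex s G) then show ?case using Ex.IH[of "s # \<Gamma>"] by simp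
qed (auto intro: has_ty_append)

section \<open>The encoding yields instances of the monadic fragment\<close>

lemma enc_fns_nth:
  "enc_fns Fs Ps ! 0 = Iota" "enc_fns Fs Ps ! 1 = tok_ty"
  "c < length Fs \<Longrightarrow> enc_fns Fs Ps ! (c + 2) = enc_ty (Fs ! c)"
  "P < length Ps \<Longrightarrow> enc_fns Fs Ps ! (P + (length Fs + 2)) = enc_ty (Ps ! P)"
  by (auto simp: enc_fns_def nth_append)

lemma length_enc_fns [simp]: "length (enc_fns Fs Ps) = length Fs + length Ps + 2"
  by (simp add: enc_fns_def)

lemma length_enc_preds [simp]: "length (enc_preds Ps) = Suc (length Ps)"
  by (simp add: enc_preds_def)

lemma enc_preds_nth: "P \<le> length Ps \<Longrightarrow> enc_preds Ps ! P = Fun Iota Prop"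
  by (cases P) (simp_all add: enc_preds_def)

lemma has_ty_enc:
  assumes "has_ty Fs Ps \<Gamma> t a"
  shows "has_ty (enc_fns Fs Ps) (enc_preds Ps) (map enc_ty \<Gamma>) (enc_tm (length Fs + 2) t) (enc_ty a)"
  using assms
proof (induction rule: has_ty.induct)
  case (1 i) then show ?case by (auto intro: has_ty_Var)
next
  case (2 c) then show ?case by (auto intro!: has_ty_Fn simp: enc_fns_nth[simplified])
next
  case (3 P) then show ?case
    by (auto intro!: has_ty_Fn simp: enc_fns_nth[simplified])
next
  case (4 s a b t) then show ?case by (auto intro: has_ty.intros)
qed

lemma has_ty_dummy: "has_ty (enc_fns Fs Ps) (enc_preds Ps) \<Gamma> (Fn 0) Iota"
  and has_ty_token: "has_ty (enc_fns Fs Ps) (enc_preds Ps) \<Gamma> (Fn 1) tok_ty"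
  by (rule has_ty_Fn; simp add: enc_fns_nth[simplified])+

lemma has_ty_enc_pred:
  "P \<le> length Ps \<Longrightarrow> has_ty Fs' (enc_preds Ps) \<Gamma> (Pred P) (Fun Iota Prop)"
  by (rule has_ty_Pred) (simp_all add: enc_preds_nth)

lemma wf_goal_enc:
  assumes "wf_goal Fs Ps \<Gamma> G"
  shows "wf_goal (enc_fns Fs Ps) (enc_preds Ps) (map enc_ty \<Gamma>) (enc_goal (length Fs + 2) G)"
  using assms
proof (induction G arbitrary: \<Gamma>)
  case (Atom A)
  then have "has_ty Fs Ps \<Gamma> A Prop" by simp
  from has_ty_enc[OF this] show ?case
    by (auto intro!: has_ty.intros(4) has_ty_enc_pred has_ty_token simp del: One_nat_def)
next
  case (Ex s G)
  from Ex.IH[of "s # \<Gamma>"] Ex.prems show ?case by (simp add: arg_ty_def)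
qed auto

lemma constr_quants_enc [simp]: "constr_quants (enc_goal n G)"
  by (induction G) simp_all

text \<open>The last argument of \<open>P y\<close>, if there is one, is a variable, whereas
  \<open>c y\<close> is a symbol or an application; hence the branch taken by
  \<open>enc_clause\<close> agrees with the form of the clause.\<close>

lemma wf_clause_cases:
  assumes "wf_clause Fs Ps (Clause ss G A)"
  obtains (pred) P where "A = apps (Pred P) (map Var [0..<length ss])"
      "enc_clause n (Clause ss G A) = [truth_clause n ss G A]"
  | (constr) P X c where "A = App (Pred P) X" "X = apps (Fn c) (map Var [0..<length ss])"
      "P < length Ps" "Ps ! P = Fun Iota Prop" "has_ty Fs Ps ss X Iota"
      "enc_clause n (Clause ss G A) = [constr_clause n ss G P X, bridge_clause n P]"
proof -
  from assms consider P where "A = apps (Pred P) (map Var [0..<length ss])"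
    | P c where "Ps ! P = Fun Iota Prop" "A = App (Pred P) (apps (Fn c) (map Var [0..<length ss]))"
    by (auto simp: Let_def)
  then show ?thesis
  proof cases
    case 1
    have "enc_clause n (Clause ss G A) = [truth_clause n ss G A]"
    proof (cases "length ss")
      case 0 with 1 show ?thesis by simp
    next
      case (Suc m)
      with 1 have A: "A = App (apps (Pred P) (map Var [0..<m])) (Var m)" by simp
      then show ?thesis by (simp split: tm.split)
    qed
    with 1 pred show ?thesis by blast
  next
    case 2
    let ?X = "apps (Fn c) (map Var [0..<length ss])"
    have "?X \<noteq> Var i" for i by (cases "length ss") simp_all
    then have *: "enc_clause n (Clause ss G A) = [constr_clause n ss G P ?X, bridge_clause n P]"
      using 2 by (simp split: tm.split)
    have "has_ty Fs Ps ss (App (Pred P) ?X) Prop" using assms 2 by simp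
    then have "P < length Ps" "has_ty Fs Ps ss ?X Iota"
      using 2(1) by (auto elim!: has_ty_AppE has_ty_PredE)
    with 2 * constr show ?thesis by blast
  qed
qed

text \<open>The former predicate symbol becomes the function symbol below \<open>Pred 0\<close>, so
  a head \<open>P y\<close> turns into one of the form \<open>P (c y)\<close>. The last variable
  supplies the argument that the encoded \<open>Prop\<close> expects.\<close>

lemma msl_clause_truth:
  assumes "wf_clause Fs Ps (Clause ss G A)" "A = apps (Pred P) (map Var [0..<length ss])"
  shows "wf_clause (enc_fns Fs Ps) (enc_preds Ps) (truth_clause (length Fs + 2) ss G A)"
    and "constr_quants_clause (truth_clause (length Fs + 2) ss G A)"
proof -
  let ?n = "length Fs + 2" and ?F = "enc_fns Fs Ps" and ?P = "enc_preds Ps"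
  let ?ss = "map enc_ty ss @ [tok_ty]"
  have A: "has_ty Fs Ps ss A Prop" and G: "wf_goal Fs Ps ss G" using assms(1) by auto
  have "has_ty ?F ?P ?ss (enc_tm ?n A) (Fun tok_ty Iota)"
    using has_ty_append[OF has_ty_enc[OF A]] by simp
  moreover have "has_ty ?F ?P ?ss (Var (length ss)) tok_ty"
    by (rule has_ty_Var) (simp_all add: nth_append)
  ultimately have "has_ty ?F ?P ?ss (App (Pred 0) (App (enc_tm ?n A) (Var (length ss)))) Prop"
    by (auto intro!: has_ty.intros(4) has_ty_enc_pred)
  moreover have "wf_goal ?F ?P ?ss (enc_goal ?n G)" using wf_goal_append[OF wf_goal_enc[OF G]] by simp
  ultimately show "wf_clause ?F ?P (truth_clause ?n ss G A)"
    using enc_tm_apps_Var[of ?n "Pred P" "length ss"] assms(2)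
    by (auto simp: truth_clause_def arg_ty_def tok_ty_def list_all_iff Let_def enc_preds_def
        simp del: upt_Suc)
  show "constr_quants_clause (truth_clause ?n ss G A)"
    by (simp add: truth_clause_def tok_ty_def list_all_iff)
qed

lemma msl_clause_constr:
  assumes "wf_clause Fs Ps (Clause ss G A)" "X = apps (Fn c) (map Var [0..<length ss])"
    "P < length Ps" "has_ty Fs Ps ss X Iota"
  shows "wf_clause (enc_fns Fs Ps) (enc_preds Ps) (constr_clause (length Fs + 2) ss G P X)"
    and "constr_quants_clause (constr_clause (length Fs + 2) ss G P X)"
proof -
  let ?n = "length Fs + 2" and ?F = "enc_fns Fs Ps" and ?P = "enc_preds Ps"
  let ?ss = "map enc_ty ss @ [Iota]"
  have G: "wf_goal Fs Ps ss G" using assms(1) by auto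
  have "has_ty ?F ?P ?ss (enc_tm ?n X) (Fun Iota Iota)"
    using has_ty_append[OF has_ty_enc[OF assms(4)]] by simp
  moreover have "has_ty ?F ?P ?ss (Var (length ss)) Iota"
    by (rule has_ty_Var) (simp_all add: nth_append)
  ultimately have "has_ty ?F ?P ?ss (App (Pred (Suc P)) (App (enc_tm ?n X) (Var (length ss)))) Prop"
    using assms(3) by (auto intro!: has_ty.intros(4) has_ty_enc_pred)
  moreover have "wf_goal ?F ?P ?ss (enc_goal ?n G)"
    using wf_goal_append[OF wf_goal_enc[OF G]] by simp
  ultimately show "wf_clause ?F ?P (constr_clause ?n ss G P X)"
    using enc_tm_apps_Var[of ?n "Fn c" "length ss"] assms(2,3)
    by (auto simp: constr_clause_def arg_ty_def list_all_iff Let_def enc_preds_def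
        simp del: upt_Suc)
  show "constr_quants_clause (constr_clause ?n ss G P X)"
    by (simp add: constr_clause_def list_all_iff)
qed

lemma msl_clause_bridge:
  assumes "P < length Ps" "Ps ! P = Fun Iota Prop"
  shows "wf_clause (enc_fns Fs Ps) (enc_preds Ps) (bridge_clause (length Fs + 2) P)"
    and "constr_quants_clause (bridge_clause (length Fs + 2) P)"
proof -
  let ?n = "length Fs + 2" and ?F = "enc_fns Fs Ps" and ?P = "enc_preds Ps"
  let ?ss = "[Fun Iota Iota, tok_ty]"
  have v0: "has_ty ?F ?P ?ss (Var 0) (Fun Iota Iota)" and v1: "has_ty ?F ?P ?ss (Var 1) tok_ty"
    by (rule has_ty_Var; simp)+
  have "has_ty ?F ?P ?ss (Fn (P + ?n)) (Fun (Fun Iota Iota) (Fun tok_ty Iota))"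
    using assms by (intro has_ty_Fn) (simp_all add: enc_fns_nth[simplified])
  from has_ty.intros(4)[OF has_ty.intros(4)[OF this v0] v1]
  have "has_ty ?F ?P ?ss (App (Pred 0) (App (App (Fn (P + ?n)) (Var 0)) (Var 1))) Prop"
    by (intro has_ty.intros(4)[OF has_ty_enc_pred]) simp_all
  moreover have "has_ty ?F ?P ?ss (App (Pred (Suc P)) (App (Var 0) (Fn 0))) Prop"
    using assms(1)
    by (intro has_ty.intros(4)[OF has_ty_enc_pred] has_ty.intros(4)[OF v0] has_ty_dummy) simp
  moreover have "\<exists>c. App (App (Fn (P + ?n)) (Var 0)) (Var 1) = apps (Fn c) (map Var [0..<2])"
    by (simp add: apps_def numeral_2_eq_2)
  ultimately show "wf_clause ?F ?P (bridge_clause ?n P)"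
    by (auto simp: bridge_clause_def arg_ty_def tok_ty_def Let_def enc_preds_def numeral_2_eq_2
        simp del: upt_Suc)
  show "constr_quants_clause (bridge_clause ?n P)" by (simp add: bridge_clause_def tok_ty_def)
qed

lemma msl_instance_enc_problem:
  assumes "homsl_instance I"
  shows "msl_instance (enc_problem I)"
proof (cases I)
  case (Problem Fs Ps D G)
  let ?n = "length Fs + 2"
  have "wf_clause (enc_fns Fs Ps) (enc_preds Ps) C' \<and> constr_quants_clause C'"
    if "C \<in> set D" and C': "C' \<in> set (enc_clause ?n C)" for C C'
  proof (cases C)
    case (Clause ss H A)
    with that(1) assms Problem have wf: "wf_clause Fs Ps (Clause ss H A)"
      by (auto simp: list_all_iff)
    from wf show ?thesis
    proof (cases rule: wf_clause_cases[where n = ?n])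
      case pred
      then show ?thesis using C' Clause msl_clause_truth[OF wf] by simp
    next
      case constr
      then show ?thesis
        using C' Clause msl_clause_constr[OF wf constr(2,3,5)] msl_clause_bridge[OF constr(3,4)]
        by auto
    qed
  qed
  moreover have "wf_goal (enc_fns Fs Ps) (enc_preds Ps) [] (enc_goal ?n G)"
    using assms Problem wf_goal_enc[of Fs Ps "[]" G] by simp
  ultimately show ?thesis using Problem
    by (auto simp: list_all_iff enc_fns_def enc_preds_def tok_ty_def)
qed

section \<open>Provability is preserved and reflected\<close>

text \<open>Function and predicate symbols both become \<open>Fn\<close>. Typing bounds the indices
  of the former by \<open>length Fs\<close>, which keeps the two ranges disjoint.\<close>

lemma enc_tm_inject:
  assumes "has_ty Fs Ps \<Gamma> s a" "has_ty Fs Ps \<Delta> t b"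
    "enc_tm (length Fs + 2) s = enc_tm (length Fs + 2) t"
  shows "s = t"
  using assms
proof (induction s arbitrary: t a b)
  case (Var i) then show ?case by (cases t) simp_all
next
  case (Fn c) then show ?case by (cases t) (auto elim!: has_ty_FnE)
next
  case (Pred P) then show ?case by (cases t) (auto elim!: has_ty_FnE)
next
  case (App s1 s2)
  then obtain t1 t2 where t: "t = App t1 t2" by (cases t) simp_all
  with App show ?case by (metis enc_tm.simps(4) has_ty_AppE tm.inject(4))
qed

text \<open>The first four types are those of the new symbols and of the results of filling a new
  argument or applying a predicate. The list is closed under application, and none of the four is an
  encoded type.\<close>

lemma closed_enc_cases:
  assumes "has_ty (enc_fns Fs Ps) (enc_preds Ps) [] t a"
  shows "a = Iota \<or> a = tok_ty \<or> a = Fun Iota Prop \<or> a = Prop \<or>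
    (\<exists>s b. has_ty Fs Ps [] s b \<and> a = enc_ty b \<and> t = enc_tm (length Fs + 2) s)"
  using assms
proof (induction rule: has_ty.induct)
  case (1 i) then show ?case by simp
next
  case (2 c)
  have "c = 0 \<or> c = 1 \<or> (\<exists>d. c = d + 2 \<and> d < length Fs) \<or>
      (\<exists>P. c = P + (length Fs + 2) \<and> P < length Ps)"
    using 2 unfolding length_enc_fns by presburger
  then consider "c = 0" | "c = 1" | d where "c = d + 2" "d < length Fs"
    | P where "c = P + (length Fs + 2)" "P < length Ps"
    by blast
  then show ?case
  proof cases
    case 3
    then have "has_ty Fs Ps [] (Fn d) (Fs ! d)" by (auto intro: has_ty_Fn)
    with 3 show ?thesis by (metis enc_fns_nth(3) enc_tm.simps(2))
  next
    case 4
    then have "has_ty Fs Ps [] (Pred P) (Ps ! P)" by (auto intro: has_ty_Pred)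
    with 4 show ?thesis by (metis enc_fns_nth(4) enc_tm.simps(3))
  qed (simp_all add: enc_fns_nth[simplified])
next
  case (3 P) then show ?case by (simp add: enc_preds_nth)
next
  case (4 s a b t)
  from 4(3) show ?case
  proof (elim disjE exE conjE)
    \<comment> \<open>The argument would have type \<open>Fun Iota (Fun Iota Iota)\<close>, which
      the induction hypothesis rules out.\<close>
    assume "Fun a b = tok_ty"
    with 4(4) show ?thesis
      by (auto simp: tok_ty_def dest: enc_ty_neq_tok_arg[symmetric, THEN notE])
  next
    fix s' c assume s': "has_ty Fs Ps [] s' c" "Fun a b = enc_ty c" "s = enc_tm (length Fs + 2) s'"
    show ?thesis
    proof (cases c)
      case (Fun c1 c2)
      with s' have ab: "a = enc_ty c1" "b = enc_ty c2" by auto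
      with 4(4) obtain t' where "has_ty Fs Ps [] t' c1" "t = enc_tm (length Fs + 2) t'"
        by auto
      with s' Fun ab have "has_ty Fs Ps [] (App s' t') c2" "App s t = enc_tm (length Fs + 2) (App s' t')"
        by (auto intro: has_ty.intros)
      with ab show ?thesis by blast
    \<comment> \<open>For a base type \<open>c\<close> the application fills the new argument, and
      the result has type \<open>Iota\<close>.\<close>
    qed (use s' in auto)
  qed auto
qed

lemma closed_enc_ty:
  assumes "has_ty (enc_fns Fs Ps) (enc_preds Ps) [] t (enc_ty a)"
  obtains s where "has_ty Fs Ps [] s a" "t = enc_tm (length Fs + 2) s"
  using closed_enc_cases[OF assms] by auto

lemma closed_enc_tys:
  assumes "list_all2 (has_ty (enc_fns Fs Ps) (enc_preds Ps) []) ts (map enc_ty ss)"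
  obtains us where "list_all2 (has_ty Fs Ps []) us ss" "ts = map (enc_tm (length Fs + 2)) us"
  using assms
proof (induction ss arbitrary: ts thesis)
  case Nil then show ?case by simp
next
  case (Cons a ss)
  from Cons.prems(2) obtain t ts' where ts: "ts = t # ts'"
    "has_ty (enc_fns Fs Ps) (enc_preds Ps) [] t (enc_ty a)"
    "list_all2 (has_ty (enc_fns Fs Ps) (enc_preds Ps) []) ts' (map enc_ty ss)"
    by (auto simp: list_all2_Cons2)
  from closed_enc_ty[OF ts(2)] obtain u
    where "has_ty Fs Ps [] u a" "t = enc_tm (length Fs + 2) u" .
  moreover from Cons.IH[OF _ ts(3)] obtain us
    where "list_all2 (has_ty Fs Ps []) us ss" "ts' = map (enc_tm (length Fs + 2)) us" .
  ultimately show ?case using ts(1) Cons.prems(1)[of "u # us"] by simp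
qed

text \<open>The dummy variable \<open>Var (length ss)\<close> occurs in the head only, as its
  innermost last argument; there it is replaced by \<open>k\<close>.\<close>

lemma subst_enc_clause:
  assumes "wf_clause Fs Ps (Clause ss G A)" "length ts = length ss"
  shows "subst_goal 0 (map (enc_tm n) ts @ [k]) (enc_goal (length Fs + 2) G)
      = subst_goal 0 (map (enc_tm n) ts) (enc_goal (length Fs + 2) G)"
    and "has_ty Fs Ps ss t a \<Longrightarrow>
      subst_tm 0 (map (enc_tm n) ts @ [k]) (App (enc_tm (length Fs + 2) t) (Var (length ss)))
      = App (subst_tm 0 (map (enc_tm n) ts) (enc_tm (length Fs + 2) t)) k"
proof -
  have "wf_goal Fs Ps ss G" using assms(1) by simp
  from subst_goal_append[OF wf_goal_enc[OF this]] assms(2)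
  show "subst_goal 0 (map (enc_tm n) ts @ [k]) (enc_goal (length Fs + 2) G)
      = subst_goal 0 (map (enc_tm n) ts) (enc_goal (length Fs + 2) G)" by simp
next
  assume "has_ty Fs Ps ss t a"
  from subst_tm_append[OF has_ty_enc[OF this]] assms(2)
  show "subst_tm 0 (map (enc_tm n) ts @ [k]) (App (enc_tm (length Fs + 2) t) (Var (length ss)))
      = App (subst_tm 0 (map (enc_tm n) ts) (enc_tm (length Fs + 2) t)) k"
    by (simp add: nth_append)
qed

text \<open>Every inference is simulated by one inference, except for a clause with head
  \<open>P (c y)\<close>, which takes two: its encoding and then the bridge clause.\<close>

lemma proves_enc:
  assumes D: "\<forall>C\<in>set D. wf_clause Fs Ps C" and "proves Fs Ps D G"
  defines "n \<equiv> length Fs + 2"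
  shows "proves (enc_fns Fs Ps) (enc_preds Ps) (concat (map (enc_clause n) D)) (enc_goal n G)"
    (is "proves ?F ?P ?D _")
  using assms(2)
proof (induction rule: proves.induct)
  case (3 t s G)
  have "has_ty ?F ?P [] (enc_tm n t) (enc_ty s)" using has_ty_enc[OF 3(1)] by (simp add: n_def)
  moreover have "proves ?F ?P ?D (subst_goal 0 [enc_tm n t] (enc_goal n G))"
    using 3(3) by (simp add: enc_goal_subst)
  ultimately show ?case by (simp add: proves.intros(3))
next
  case (4 ss G A ts)
  have wf: "wf_clause Fs Ps (Clause ss G A)" using D 4(1) by blast
  have len: "length ts = length ss" using 4(2) by (rule list_all2_lengthD)
  let ?ts = "map (enc_tm n) ts"
  have ts: "list_all2 (has_ty ?F ?P []) ?ts (map enc_ty ss)"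
    using 4(2) has_ty_enc[of Fs Ps "[]"]
    by (auto simp: list_all2_conv_all_nth n_def)
  have G: "proves ?F ?P ?D (subst_goal 0 (?ts @ [k]) (enc_goal n G))" for k
    using 4(4) subst_enc_clause(1)[OF wf len, of n k] by (simp add: enc_goal_subst n_def)
  from wf show ?case
  proof (cases rule: wf_clause_cases[where n = n])
    case pred
    have A: "has_ty Fs Ps ss A Prop" using wf by simp
    have "truth_clause n ss G A \<in> set ?D" using 4(1) pred(2) by force
    \<comment> \<open>The dummy is instantiated with \<open>Fn 1\<close>, the constant that
      \<open>enc_goal\<close> puts into atoms.\<close>
    from proves.intros(4)[OF this[unfolded truth_clause_def], of ?F ?P "?ts @ [Fn 1]"]
    have "proves ?F ?P ?D (Atom (subst_tm 0 (?ts @ [Fn 1])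
        (App (Pred 0) (App (enc_tm n A) (Var (length ss))))))"
      using ts G has_ty_token by (simp add: list_all2_appendI)
    then show ?thesis
      using subst_enc_clause(2)[OF wf len A, of n "Fn 1"] by (simp add: enc_tm_subst n_def)
  next
    case (constr P X c)
    have "constr_clause n ss G P X \<in> set ?D" and bridge: "bridge_clause n P \<in> set ?D"
      using 4(1) constr(6) by force+
    \<comment> \<open>Here the dummy must be \<open>Fn 0\<close>, the constant in the body of the
      bridge clause.\<close>
    from proves.intros(4)[OF this(1)[unfolded constr_clause_def], of ?F ?P "?ts @ [Fn 0]"]
    have "proves ?F ?P ?D (Atom (subst_tm 0 (?ts @ [Fn 0])
        (App (Pred (Suc P)) (App (enc_tm n X) (Var (length ss))))))"
      using ts G has_ty_dummy by (simp add: list_all2_appendI)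
    then have "proves ?F ?P ?D
        (Atom (App (Pred (Suc P)) (App (enc_tm n (subst_tm 0 ts X)) (Fn 0))))"
      using subst_enc_clause(2)[OF wf len constr(5), of n "Fn 0"]
      by (simp add: enc_tm_subst n_def)
    moreover have "has_ty ?F ?P [] (enc_tm n (subst_tm 0 ts X)) (Fun Iota Iota)"
      using has_ty_enc[OF has_ty_subst[where \<Delta> = "[]" and ts = ts], of Fs Ps ss X Iota] 4(2) constr(5)
      by (simp add: n_def)
    ultimately show ?thesis
      using proves.intros(4)[OF bridge[unfolded bridge_clause_def], of ?F ?P
          "[enc_tm n (subst_tm 0 ts X), Fn 1]"] constr(1) has_ty_token
      by simp
  qed
qed (auto intro: proves.intros)

text \<open>The last two conjuncts allow an arbitrary dummy argument \<open>u\<close>, because clause heads end in a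
  variable of the dummy type.\<close>

lemma proves_enc_reflect:
  assumes D: "\<forall>C\<in>set D. wf_clause Fs Ps C"
  defines "n \<equiv> length Fs + 2"
  assumes "proves (enc_fns Fs Ps) (enc_preds Ps) (concat (map (enc_clause n) D)) H"
    (is "proves ?F ?P ?D _")
  shows "(\<forall>G. wf_goal Fs Ps [] G \<longrightarrow> H = enc_goal n G \<longrightarrow> proves Fs Ps D G) \<and>
    (\<forall>A u. has_ty Fs Ps [] A Prop \<longrightarrow> H = Atom (App (Pred 0) (App (enc_tm n A) u)) \<longrightarrow>
       proves Fs Ps D (Atom A)) \<and>
    (\<forall>P t u. has_ty Fs Ps [] (App (Pred P) t) Prop \<longrightarrow>
       H = Atom (App (Pred (Suc P)) (App (enc_tm n t) u)) \<longrightarrow>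
       proves Fs Ps D (Atom (App (Pred P) t)))"
  using assms(3)
proof (induction rule: proves.induct)
  case 1
  have "proves Fs Ps D G" if "Truth = enc_goal n G" for G
    using that by (cases G) (auto intro: proves.intros)
  then show ?case by auto
next
  case (2 G1 G2)
  have "proves Fs Ps D G" if "wf_goal Fs Ps [] G" "Conj G1 G2 = enc_goal n G" for G
    using that 2 by (cases G) (auto intro: proves.intros)
  then show ?case by auto
next
  case (3 t s H)
  have "proves Fs Ps D G" if wf: "wf_goal Fs Ps [] G" and enc: "Ex s H = enc_goal n G" for G
  proof -
    from enc obtain a G' where G: "G = Ex a G'" "s = enc_ty a" "H = enc_goal n G'"
      by (cases G) auto
    \<comment> \<open>A witness of an encoded type is the encoding of a witness for the original
      quantifier.\<close>
    from closed_enc_ty[of Fs Ps t a] 3(1) G(2) obtain u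
      where u: "has_ty Fs Ps [] u a" "t = enc_tm n u" by (auto simp: n_def)
    have "wf_goal Fs Ps [] (subst_goal 0 [u] G')"
      using wf_goal_subst[of Fs Ps "[]" "[a]" G' "[u]"] wf G(1) u(1) by simp
    then have "proves Fs Ps D (subst_goal 0 [u] G')"
      using 3(3) u(2) G(3) by (auto simp: enc_goal_subst)
    then show ?thesis using u(1) G(1) by (auto intro: proves.intros)
  qed
  then show ?case by auto
next
  case (4 ss' G' A' ts)
  from 4(1) obtain ss G A where C: "Clause ss G A \<in> set D"
    "Clause ss' G' A' \<in> set (enc_clause n (Clause ss G A))"
    by (auto simp del: enc_clause.simps) (metis clause.exhaust)
  have wf: "wf_clause Fs Ps (Clause ss G A)" using D C(1) by blast
  then have wfG: "wf_goal Fs Ps ss G" and A: "has_ty Fs Ps ss A Prop" by auto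
  \<comment> \<open>The dummy \<open>k\<close> does not reach the body, so the induction hypothesis
    proves the original body, and the original clause applies with the decoded terms
    \<open>us\<close>.\<close>
  have main: "proves Fs Ps D (Atom (subst_tm 0 us A)) \<and> has_ty Fs Ps [] (subst_tm 0 us A) Prop \<and>
      (\<forall>t a. has_ty Fs Ps ss t a \<longrightarrow>
         subst_tm 0 ts (App (enc_tm n t) (Var (length ss))) = App (enc_tm n (subst_tm 0 us t)) k)"
    if us: "list_all2 (has_ty Fs Ps []) us ss" "ts = map (enc_tm n) us @ [k]" "G' = enc_goal n G"
    for us k
  proof -
    have len: "length us = length ss" using us(1) by (rule list_all2_lengthD)
    have "wf_goal Fs Ps [] (subst_goal 0 us G)"
      using wf_goal_subst[of Fs Ps "[]" ss G us] us(1) wfG by simp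
    moreover have "subst_goal 0 ts G' = enc_goal n (subst_goal 0 us G)"
      using subst_enc_clause(1)[OF wf len, of n k] us by (simp add: enc_goal_subst n_def)
    ultimately have "proves Fs Ps D (subst_goal 0 us G)" using 4(4) by auto
    from proves.intros(4)[OF C(1) us(1) this] show ?thesis
      using subst_enc_clause(2)[OF wf len, of _ _ n k] us
        has_ty_subst[of Fs Ps "[]" ss A Prop us] A
      by (auto simp: enc_tm_subst n_def)
  qed
  \<comment> \<open>All terms but the last have encoded types and therefore decode; the dummy
    \<open>k\<close> may be any closed term of its type.\<close>
  have split: "\<exists>us k. list_all2 (has_ty Fs Ps []) us ss \<and> ts = map (enc_tm n) us @ [k]"
    if "ss' = map enc_ty ss @ [b]" for b
  proof -
    from 4(2) that obtain ts1 k where "ts = ts1 @ [k]"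
      "list_all2 (has_ty ?F ?P []) ts1 (map enc_ty ss)"
      by (auto simp: list_all2_append2 list_all2_Cons2)
    with closed_enc_tys[of Fs Ps ts1 ss] show ?thesis by (metis n_def)
  qed
  have inj: "s = t" if "has_ty Fs Ps [] s a" "has_ty Fs Ps [] t b" "enc_tm n s = enc_tm n t" for s t a b
    using enc_tm_inject[OF that(1,2)] that(3) by (simp add: n_def)
  \<comment> \<open>For a conclusion under \<open>Pred 0\<close>, injectivity of
    \<open>enc_tm\<close> identifies the decoded atom with \<open>B\<close>, and the conjunct about
    \<open>Pred (Suc P)\<close> holds vacuously.\<close>
  have truth: "?case" if "has_ty Fs Ps [] B Prop" "proves Fs Ps D (Atom B)"
      "subst_tm 0 ts A' = App (Pred 0) (App (enc_tm n B) k)" for B k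
  proof -
    have "proves Fs Ps D H" if "wf_goal Fs Ps [] H" "Atom (subst_tm 0 ts A') = enc_goal n H" for H
      using that \<open>subst_tm 0 ts A' = _\<close> inj[OF \<open>has_ty Fs Ps [] B Prop\<close>] \<open>proves Fs Ps D (Atom B)\<close>
      by (cases H) auto
    with that inj[OF that(1)] show ?thesis by auto
  qed
  from wf show ?case
  proof (cases rule: wf_clause_cases[where n = n])
    case pred
    then have C': "ss' = map enc_ty ss @ [tok_ty]" "G' = enc_goal n G"
      "A' = App (Pred 0) (App (enc_tm n A) (Var (length ss)))"
      using C(2) by (simp_all add: truth_clause_def)
    from split[OF C'(1)] obtain us k where us: "list_all2 (has_ty Fs Ps []) us ss"
      "ts = map (enc_tm n) us @ [k]" by blast
    note m = main[OF us C'(2)]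
    note eq = m[THEN conjunct2, THEN conjunct2, rule_format, OF A]
    have "subst_tm 0 ts A' = App (Pred 0) (App (enc_tm n (subst_tm 0 us A)) k)"
      using eq by (simp only: C'(3) subst_tm.simps(3,4))
    with m show ?thesis by (intro truth) simp_all
  next
    case (constr P X c)
    with C(2) consider "Clause ss' G' A' = constr_clause n ss G P X"
      | "Clause ss' G' A' = bridge_clause n P" by auto
    then show ?thesis
    proof cases
      case 1
      then have C': "ss' = map enc_ty ss @ [Iota]" "G' = enc_goal n G"
        "A' = App (Pred (Suc P)) (App (enc_tm n X) (Var (length ss)))"
        by (simp_all add: constr_clause_def)
      from split[OF C'(1)] obtain us k where us: "list_all2 (has_ty Fs Ps []) us ss"
        "ts = map (enc_tm n) us @ [k]" by blast
      have X: "has_ty Fs Ps [] (subst_tm 0 us X) Iota"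
        using has_ty_subst[of Fs Ps "[]" ss X Iota us] us(1) constr(5) by simp
      have A'eq: "subst_tm 0 ts A' = App (Pred (Suc P)) (App (enc_tm n (subst_tm 0 us X)) k)"
        using main[OF us C'(2), THEN conjunct2, THEN conjunct2, rule_format, OF constr(5)]
        by (simp only: C'(3) subst_tm.simps(3,4))
      \<comment> \<open>Encoded atoms start with \<open>Pred 0\<close>, so only the last conjunct
        concerns this head.\<close>
      have "Atom (subst_tm 0 ts A') \<noteq> enc_goal n H" for H
        unfolding A'eq by (cases H) auto
      moreover have "proves Fs Ps D (Atom (App (Pred P) (subst_tm 0 us X)))"
        using main[OF us C'(2)] constr(1) by simp
      ultimately show ?thesis
        unfolding A'eq using inj[OF X] by (auto elim!: has_ty_AppE)
    next
      case 2
      then have C': "ss' = [Fun Iota Iota, tok_ty]"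
        "G' = Atom (App (Pred (Suc P)) (App (Var 0) (Fn 0)))"
        "A' = App (Pred 0) (App (App (Fn (P + n)) (Var 0)) (Var 1))"
        by (simp_all add: bridge_clause_def)
      \<comment> \<open>\<open>Fun Iota Iota\<close> is \<open>enc_ty Iota\<close>, so the term
        \<open>x\<close> decodes.\<close>
      from 4(2) C'(1) obtain x k where ts: "ts = [x, k]" "has_ty ?F ?P [] x (enc_ty Iota)"
        by (auto simp: list_all2_Cons2)
      from closed_enc_ty[OF ts(2)] obtain t where t: "has_ty Fs Ps [] t Iota" "x = enc_tm n t"
        by (auto simp: n_def)
      have Pt: "has_ty Fs Ps [] (App (Pred P) t) Prop"
        using constr(3,4) t(1) by (auto intro!: has_ty.intros(4)[of _ _ _ _ Iota] has_ty_Pred)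
      \<comment> \<open>This is the last conjunct of the induction hypothesis for the body, with
        \<open>Fn 0\<close> as \<open>u\<close>.\<close>
      have "proves Fs Ps D (Atom (App (Pred P) t))"
        using 4(4) Pt unfolding C'(2) ts(1) t(2) by auto
      from truth[OF Pt this] show ?thesis using C'(3) ts(1) t(2) by simp
    qed
  qed
qed

lemma provable_enc_problem:
  assumes "homsl_instance I"
  shows "provable (enc_problem I) \<longleftrightarrow> provable I"
proof (cases I)
  case (Problem Fs Ps D G)
  with assms have "\<forall>C\<in>set D. wf_clause Fs Ps C" "wf_goal Fs Ps [] G"
    by (auto simp: list_all_iff)
  with Problem proves_enc proves_enc_reflect show ?thesis by auto
qed

section \<open>Invariance under the identification of formulas\<close>

lemma goal_eq_enc: "goal_eq G H \<Longrightarrow> goal_eq (enc_goal n G) (enc_goal n H)"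
proof (induction rule: goal_eq.induct)
  case (3 G H K) then show ?case by (blast intro: goal_eq.intros(3))
qed (auto intro: goal_eq.intros)

text \<open>Both clauses have the same head, and \<open>enc_clause\<close> branches on the head
  only.\<close>

lemma clause_eq_enc:
  "clause_eq C C' \<Longrightarrow> list_all2 clause_eq (enc_clause n C) (enc_clause n C')"
  by (cases C; cases C')
    (auto split: tm.split intro: goal_eq_enc goal_eq.intros(1)
      simp: truth_clause_def constr_clause_def bridge_clause_def)

text \<open>Permute both lists so that related entries are aligned; the multiset of a concatenation
  depends only on the multiset of the concatenated lists.\<close>

lemma rel_mset_concat_map:
  assumes "rel_mset R (mset xs) (mset ys)" "\<And>x y. R x y \<Longrightarrow> list_all2 Q (f x) (f y)"
  shows "rel_mset Q (mset (concat (map f xs))) (mset (concat (map f ys)))"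
proof -
  from assms(1) obtain xs' ys' where *: "mset xs' = mset xs" "mset ys' = mset ys"
    "list_all2 R xs' ys'" by (auto simp: rel_mset_def)
  from *(3) have "list_all2 Q (concat (map f xs')) (concat (map f ys'))"
    by induction (auto intro: list_all2_appendI assms(2))
  moreover have "mset (concat (map f zs)) = (\<Sum>z\<in>#mset zs. mset (f z))" for zs
    by (induction zs) auto
  ultimately show ?thesis using * unfolding rel_mset_def by metis
qed

lemma problem_eq_enc: "problem_eq I J \<Longrightarrow> problem_eq (enc_problem I) (enc_problem J)"
  by (cases I; cases J)
    (auto intro: goal_eq_enc rel_mset_concat_map[OF _ clause_eq_enc] simp del: mset_concat)

section \<open>Total recursive functions\<close>

text \<open>Functions take the whole argument tuple, so that closure properties act as introduction
  rules on the body of a lambda term.\<close>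

definition total_rec :: "nat \<Rightarrow> (nat list \<Rightarrow> nat) \<Rightarrow> bool" where
  "total_rec n f \<longleftrightarrow> (\<exists>r. \<forall>xs. length xs = n \<longrightarrow> rec_val r xs = Some (f xs))"

definition rec1 :: "(nat \<Rightarrow> nat) \<Rightarrow> bool" where
  "rec1 f \<longleftrightarrow> total_rec 1 (\<lambda>xs. f (xs ! 0))"

definition rec2 :: "(nat \<Rightarrow> nat \<Rightarrow> nat) \<Rightarrow> bool" where
  "rec2 f \<longleftrightarrow> total_rec 2 (\<lambda>xs. f (xs ! 0) (xs ! 1))"

definition rec3 :: "(nat \<Rightarrow> nat \<Rightarrow> nat \<Rightarrow> nat) \<Rightarrow> bool" where
  "rec3 f \<longleftrightarrow> total_rec 3 (\<lambda>xs. f (xs ! 0) (xs ! 1) (xs ! 2))"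

lemma total_rec_nth: "i < n \<Longrightarrow> total_rec n (\<lambda>xs. xs ! i)"
  unfolding total_rec_def by (rule exI[of _ "Id i"]) simp

lemma total_rec_Suc:
  assumes "total_rec n f" shows "total_rec n (\<lambda>xs. Suc (f xs))"
proof -
  from assms obtain r where "\<forall>xs. length xs = n \<longrightarrow> rec_val r xs = Some (f xs)"
    by (auto simp: total_rec_def)
  then show ?thesis unfolding total_rec_def by (intro exI[of _ "Cn S [r]"]) simp
qed

lemma total_rec_const: "total_rec n (\<lambda>_. c)"
proof (induction c)
  case 0 show ?case unfolding total_rec_def by (rule exI[of _ Z]) simp
qed (rule total_rec_Suc)

lemma total_rec_comp1:
  assumes "rec1 f" "total_rec n g" shows "total_rec n (\<lambda>xs. f (g xs))"
proof -
  from assms obtain r s where "\<forall>xs. length xs = 1 \<longrightarrow> rec_val r xs = Some (f (xs ! 0))"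
    "\<forall>xs. length xs = n \<longrightarrow> rec_val s xs = Some (g xs)"
    unfolding total_rec_def rec1_def by blast
  then show ?thesis unfolding total_rec_def by (intro exI[of _ "Cn r [s]"]) simp
qed

lemma total_rec_comp2:
  assumes "rec2 f" "total_rec n g" "total_rec n h"
  shows "total_rec n (\<lambda>xs. f (g xs) (h xs))"
proof -
  from assms obtain r s t where "\<forall>xs. length xs = 2 \<longrightarrow> rec_val r xs = Some (f (xs ! 0) (xs ! 1))"
    "\<forall>xs. length xs = n \<longrightarrow> rec_val s xs = Some (g xs)"
    "\<forall>xs. length xs = n \<longrightarrow> rec_val t xs = Some (h xs)"
    unfolding total_rec_def rec2_def by blast
  then show ?thesis unfolding total_rec_def by (intro exI[of _ "Cn r [s, t]"]) simp
qed

lemma total_rec_comp3: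
  assumes "rec3 f" "total_rec n g" "total_rec n h" "total_rec n k"
  shows "total_rec n (\<lambda>xs. f (g xs) (h xs) (k xs))"
proof -
  from assms obtain r s t u where
    "\<forall>xs. length xs = 3 \<longrightarrow> rec_val r xs = Some (f (xs ! 0) (xs ! 1) (xs ! 2))"
    "\<forall>xs. length xs = n \<longrightarrow> rec_val s xs = Some (g xs)"
    "\<forall>xs. length xs = n \<longrightarrow> rec_val t xs = Some (h xs)"
    "\<forall>xs. length xs = n \<longrightarrow> rec_val u xs = Some (k xs)"
    unfolding total_rec_def rec3_def by blast
  then show ?thesis unfolding total_rec_def by (intro exI[of _ "Cn r [s, t, u]"]) simp
qed

lemma rec1_primrec:
  assumes "rec2 s" "\<And>i. f (Suc i) = s i (f i)"
  shows "rec1 f"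
proof -
  \<comment> \<open>With a single argument, \<open>Pr\<close> calls its base function on the empty
    tuple.\<close>
  have "total_rec 0 (\<lambda>_. f 0)" by (rule total_rec_const)
  with assms(1) obtain r t where r: "rec_val r [] = Some (f 0)"
    and t: "\<And>xs. length xs = 2 \<Longrightarrow> rec_val t xs = Some (s (xs ! 0) (xs ! 1))"
    unfolding total_rec_def rec2_def by auto
  have "rec_val (Pr r t) [i] = Some (f i)" for i
    by (induction i) (simp_all add: r t assms(2))
  then show ?thesis unfolding total_rec_def rec1_def
    by (intro exI[of _ "Pr r t"]) (auto simp: length_Suc_conv simp del: rec_val.simps)
qed

lemma rec2_primrec:
  assumes "rec1 b" "rec3 s" "\<And>y. f 0 y = b y" "\<And>i y. f (Suc i) y = s i (f i y) y"
  shows "rec2 f"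
proof -
  from assms(1,2) obtain r t where r: "\<And>xs. length xs = 1 \<Longrightarrow> rec_val r xs = Some (b (xs ! 0))"
    and t: "\<And>xs. length xs = 3 \<Longrightarrow> rec_val t xs = Some (s (xs ! 0) (xs ! 1) (xs ! 2))"
    unfolding total_rec_def rec1_def rec3_def by blast
  have "rec_val (Pr r t) [i, y] = Some (f i y)" for i y
    by (induction i) (simp_all add: r t assms(3,4))
  then show ?thesis unfolding total_rec_def rec2_def
    by (intro exI[of _ "Pr r t"])
      (auto simp: length_Suc_conv numeral_2_eq_2 simp del: rec_val.simps)
qed

named_theorems total_rec_intros

lemmas [total_rec_intros] = total_rec_nth total_rec_const total_rec_Suc

lemma rec2_swap: "rec2 f \<Longrightarrow> rec2 (\<lambda>x y. f y x)"
  unfolding rec2_def[of "\<lambda>x y. f y x"]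
  by (intro total_rec_comp2[of f] total_rec_intros) simp_all

section \<open>Arithmetic and case distinction\<close>

lemma rec2_add: "rec2 (+)"
  by (rule rec2_primrec[where b = "\<lambda>y. y" and s = "\<lambda>_ v _. Suc v"])
    (auto simp: rec1_def rec3_def intro!: total_rec_intros)
lemmas [total_rec_intros] = total_rec_comp2[OF rec2_add]

lemma rec1_pred: "rec1 (\<lambda>n. n - 1)"
  by (rule rec1_primrec[where s = "\<lambda>i _. i"]) (auto simp: rec2_def intro!: total_rec_intros)
lemmas [total_rec_intros] = total_rec_comp1[OF rec1_pred]

lemma rec2_diff: "rec2 (-)"
proof -
  \<comment> \<open>Recursion runs on the first argument, but subtraction recurses on the
    subtrahend; the arguments are swapped afterwards.\<close>
  have "rec2 (\<lambda>m n. n - m)"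
    by (rule rec2_primrec[where b = "\<lambda>y. y" and s = "\<lambda>_ v _. v - 1"])
      (auto simp: rec1_def rec3_def simp del: One_nat_def intro!: total_rec_intros)
  from rec2_swap[OF this] show ?thesis .
qed
lemmas [total_rec_intros] = total_rec_comp2[OF rec2_diff]

lemma rec2_mult: "rec2 (*)"
  by (rule rec2_primrec[where b = "\<lambda>_. 0" and s = "\<lambda>_ v y. y + v"])
    (auto simp: rec1_def rec3_def intro!: total_rec_intros)
lemmas [total_rec_intros] = total_rec_comp2[OF rec2_mult]

text \<open>Under truncated subtraction, \<open>(f xs - g xs) + (g xs - f xs)\<close> is 0 exactly
  in the case of equality, and \<open>1 - d\<close> tests whether \<open>d\<close> is 0.\<close>

lemma total_rec_if_eq [total_rec_intros]:
  assumes "total_rec n f" "total_rec n g" "total_rec n h" "total_rec n k"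
  shows "total_rec n (\<lambda>xs. if f xs = g xs then h xs else k xs)"
proof -
  have "total_rec n (\<lambda>xs. h xs * (1 - ((f xs - g xs) + (g xs - f xs)))
      + k xs * (1 - (1 - ((f xs - g xs) + (g xs - f xs)))))"
    by (intro total_rec_intros assms)
  moreover have "h xs * (1 - ((f xs - g xs) + (g xs - f xs)))
      + k xs * (1 - (1 - ((f xs - g xs) + (g xs - f xs))))
      = (if f xs = g xs then h xs else k xs)" for xs
    by (cases "f xs" "g xs" rule: linorder_cases) auto
  ultimately show ?thesis by simp
qed

section \<open>Decoding of lists\<close>

lemma rec1_triangle: "rec1 triangle"
  by (rule rec1_primrec[where s = "\<lambda>i v. v + Suc i"])
    (auto simp: rec2_def intro!: total_rec_intros)
lemmas [total_rec_intros] = total_rec_comp1[OF rec1_triangle]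

text \<open>\<open>diagonal z\<close> is the sum of the two components of \<open>prod_decode z\<close>.\<close>

primrec diagonal :: "nat \<Rightarrow> nat" where
  "diagonal 0 = 0"
| "diagonal (Suc z) =
    (if Suc z = triangle (Suc (diagonal z)) then Suc (diagonal z) else diagonal z)"

lemma rec1_diagonal: "rec1 diagonal"
  by (rule rec1_primrec[where s = "\<lambda>i v. if Suc i = triangle (Suc v) then Suc v else v"])
    (auto simp: rec2_def simp del: triangle_Suc intro!: total_rec_intros)
lemmas [total_rec_intros] = total_rec_comp1[OF rec1_diagonal]

text \<open>The value increases exactly when \<open>z\<close> reaches the next triangular number, so
  it is the largest \<open>d\<close> with \<open>triangle d \<le> z\<close>.\<close>

lemma diagonal_bounds: "triangle (diagonal z) \<le> z \<and> z < triangle (Suc (diagonal z))"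
  by (induction z) auto

text \<open>\<open>prod_encode (a, b)\<close> is \<open>triangle (a + b) + a\<close>. By the upper
  bound the second subtraction is not truncated.\<close>

lemma prod_decode_diagonal:
  "prod_decode z = (z - triangle (diagonal z), diagonal z - (z - triangle (diagonal z)))"
proof -
  have "prod_encode (z - triangle (diagonal z), diagonal z - (z - triangle (diagonal z))) = z"
    using diagonal_bounds[of z] by (simp add: prod_encode_def)
  then show ?thesis by (metis prod_encode_inverse)
qed

definition cons_code :: "nat \<Rightarrow> nat \<Rightarrow> nat" where
  "cons_code x l = Suc (prod_encode (x, l))"

definition hd_code :: "nat \<Rightarrow> nat" where
  "hd_code l = fst (prod_decode (l - 1))"

definition tl_code :: "nat \<Rightarrow> nat" where
  "tl_code l = snd (prod_decode (l - 1))"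

lemma hd_code_cons [simp]: "hd_code (cons_code x l) = x"
  and tl_code_cons [simp]: "tl_code (cons_code x l) = l"
  and cons_code_neq_0 [simp]: "cons_code x l \<noteq> 0"
  by (simp_all add: hd_code_def tl_code_def cons_code_def)

text \<open>Codes of components are smaller than the whole code, as course-of-values recursion
  requires. The premise lets the bounds chain through nested codes.\<close>

lemma less_cons_code_hd: "y \<le> x \<Longrightarrow> y < cons_code x l"
  and less_cons_code_tl: "y \<le> l \<Longrightarrow> y < cons_code x l"
  using le_prod_encode_1[of x l] le_prod_encode_2[of l x] by (simp_all add: cons_code_def)

lemma le_cons_code_hd: "y \<le> x \<Longrightarrow> y \<le> cons_code x l"
  and le_cons_code_tl: "y \<le> l \<Longrightarrow> y \<le> cons_code x l"
  by (simp_all add: less_cons_code_hd less_cons_code_tl less_imp_le)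

lemmas cons_code_bounds =
  less_cons_code_hd less_cons_code_tl le_cons_code_hd le_cons_code_tl

lemma list_encode_cons: "list_encode (x # xs) = cons_code x (list_encode xs)"
  by (simp add: cons_code_def)

declare list_encode.simps(2) [simp del] list_encode_cons [simp]

lemma rec2_cons_code: "rec2 cons_code"
  unfolding rec2_def cons_code_def prod_encode_def prod.case
  by (intro total_rec_intros) simp_all
lemmas [total_rec_intros] = total_rec_comp2[OF rec2_cons_code]

lemma rec1_hd_code: "rec1 hd_code"
  unfolding rec1_def hd_code_def prod_decode_diagonal fst_conv
  by (intro total_rec_intros) simp_all
lemmas [total_rec_intros] = total_rec_comp1[OF rec1_hd_code]

lemma rec1_tl_code: "rec1 tl_code"
  unfolding rec1_def tl_code_def prod_decode_diagonal snd_conv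
  by (intro total_rec_intros) simp_all
lemmas [total_rec_intros] = total_rec_comp1[OF rec1_tl_code]

section \<open>Course-of-values recursion\<close>

text \<open>\<open>h\<close> codes the list of the values at \<open>x - 1, \<dots>, 0\<close>, most recent first.\<close>

definition lookup :: "nat \<Rightarrow> nat \<Rightarrow> nat \<Rightarrow> nat" where
  "lookup x h y = hd_code ((tl_code ^^ (x - Suc y)) h)"

lemma rec3_lookup: "rec3 lookup"
proof -
  have "rec2 (\<lambda>i. tl_code ^^ i)"
    by (rule rec2_primrec[where b = "\<lambda>y. y" and s = "\<lambda>_ v _. tl_code v"])
      (auto simp: rec1_def rec3_def intro!: total_rec_intros)
  note [total_rec_intros] = total_rec_comp2[OF this]
  show ?thesis unfolding rec3_def lookup_def
    by (intro total_rec_intros) simp_all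
qed
lemmas [total_rec_intros] = total_rec_comp3[OF rec3_lookup]

text \<open>Primitive recursion builds the history \<open>H x p\<close> of the values below
  \<open>x\<close>, and \<open>f\<close> applies \<open>s\<close> to it once more. Only the lookups
  in the history matter to users, so \<open>h\<close> stays existential.\<close>

lemma course_of_values:
  assumes "rec3 s"
  obtains f where "rec2 f"
    "\<And>x p. \<exists>h. (\<forall>y<x. lookup x h y = f y p) \<and> f x p = s x h p"
proof -
  define H where "H x p = rec_nat 0 (\<lambda>i v. cons_code (s i v p) v) x" for x p
  define f where "f x p = s x (H x p) p" for x p
  note [total_rec_intros] = total_rec_comp3[OF assms]
  have "rec2 H"
    by (rule rec2_primrec[where b = "\<lambda>_. 0" and s = "\<lambda>i v p. cons_code (s i v p) v"])
      (auto simp: H_def rec1_def rec3_def intro!: total_rec_intros)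
  note [total_rec_intros] = total_rec_comp2[OF this]
  have "rec2 f" unfolding rec2_def f_def by (intro total_rec_intros) simp_all
  moreover have "lookup x (H x p) y = f y p" if "y < x" for x y p
    using that
  proof (induction x)
    case (Suc x)
    show ?case
    proof (cases "y = x")
      case True then show ?thesis by (simp add: lookup_def H_def f_def)
    next
      case False
      with Suc.prems have "Suc x - Suc y = Suc (x - Suc y)" by simp
      moreover have "tl_code (H (Suc x) p) = H x p" by (simp add: H_def)
      ultimately show ?thesis using Suc False
        by (simp add: lookup_def funpow_swap1 del: funpow.simps diff_Suc_Suc) (simp add: funpow_swap1)
    qed
  qed simp
  ultimately show ?thesis using that f_def by blast
qed

text \<open>The tail has a smaller code than the list, so a fold is a course-of-values recursion on
  the code; 0 codes the empty list.\<close>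

lemma rec_foldr:
  assumes "rec1 b" "rec3 c"
  obtains f where "rec2 f" "\<And>xs p. f (list_encode xs) p = foldr (\<lambda>x v. c x v p) xs (b p)"
proof -
  note [total_rec_intros] = total_rec_comp1[OF assms(1)] total_rec_comp3[OF assms(2)]
  define s where "s x h p = (if x = 0 then b p else c (hd_code x) (lookup x h (tl_code x)) p)" for x h p
  have "rec3 s" unfolding rec3_def s_def by (intro total_rec_intros) simp_all
  then obtain f where f: "rec2 f" "\<And>x p. \<exists>h. (\<forall>y<x. lookup x h y = f y p) \<and> f x p = s x h p"
    by (rule course_of_values) blast
  have "f (list_encode xs) p = foldr (\<lambda>x v. c x v p) xs (b p)" for xs p
  proof (induction xs)
    case Nil then show ?case using f(2)[of 0 p] by (simp add: s_def)
  next
    case (Cons x xs)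
    then show ?case using f(2)[of "list_encode (x # xs)" p]
      by (auto simp: s_def less_cons_code_tl)
  qed
  with f(1) that show ?thesis by blast
qed

section \<open>Operations on coded lists\<close>

lemma rec_append:
  obtains f where "rec2 f" "\<And>xs ys. f (list_encode xs) (list_encode ys) = list_encode (xs @ ys)"
proof -
  have "rec1 (\<lambda>x. x)" "rec3 (\<lambda>x v p. cons_code x v)"
    unfolding rec1_def rec3_def by (intro total_rec_intros; simp)+
  then obtain f where f: "rec2 f"
    "\<And>xs p. f (list_encode xs) p = foldr (\<lambda>x v. cons_code x v) xs p" by (rule rec_foldr) blast
  have "foldr cons_code xs (list_encode ys) = list_encode (xs @ ys)" for xs ys
    by (induction xs) simp_all
  with f that show ?thesis by simp
qed

lemma rec_length:
  obtains f where "rec1 f" "\<And>xs. f (list_encode xs) = length xs"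
proof -
  have "rec1 (\<lambda>x. 0)" "rec3 (\<lambda>x v p. Suc v)"
    unfolding rec1_def rec3_def by (intro total_rec_intros; simp)+
  then obtain f where f: "rec2 f" "\<And>xs p. f (list_encode xs) p = foldr (\<lambda>x v. Suc v) xs 0"
    by (rule rec_foldr) blast
  have "rec1 (\<lambda>x. f x 0)" unfolding rec1_def by (intro total_rec_comp2[OF f(1)] total_rec_intros) simp
  moreover have "foldr (\<lambda>x v. Suc v) xs 0 = length xs" for xs :: "nat list" by (induction xs) simp_all
  ultimately show ?thesis using f(2) that by metis
qed

lemma rec_map:
  assumes "rec2 g"
  obtains f where "rec2 f"
    "\<And>xs p. f (list_encode xs) p = list_encode (map (\<lambda>x. g x p) xs)"
proof -
  note [total_rec_intros] = total_rec_comp2[OF assms]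
  have "rec1 (\<lambda>x. 0)" "rec3 (\<lambda>x v p. cons_code (g x p) v)"
    unfolding rec1_def rec3_def by (intro total_rec_intros; simp)+
  then obtain f where f: "rec2 f"
    "\<And>xs p. f (list_encode xs) p = foldr (\<lambda>x v. cons_code (g x p) v) xs 0" by (rule rec_foldr) blast
  have "foldr (\<lambda>x v. cons_code (g x p) v) xs 0 = list_encode (map (\<lambda>x. g x p) xs)" for xs p
    by (induction xs) simp_all
  with f that show ?thesis by simp
qed

lemma rec_concat:
  obtains f where "rec1 f" "\<And>xss. f (list_encode (map list_encode xss)) = list_encode (concat xss)"
proof -
  obtain a where a: "rec2 a"
    "\<And>xs ys. a (list_encode xs) (list_encode ys) = list_encode (xs @ ys)" using rec_append by blast
  note [total_rec_intros] = total_rec_comp2[OF a(1)]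
  have "rec1 (\<lambda>x. 0)" "rec3 (\<lambda>x v p. a x v)"
    unfolding rec1_def rec3_def by (intro total_rec_intros; simp)+
  then obtain f where f: "rec2 f" "\<And>xs p. f (list_encode xs) p = foldr a xs 0" by (rule rec_foldr) blast
  have "rec1 (\<lambda>x. f x 0)" unfolding rec1_def by (intro total_rec_comp2[OF f(1)] total_rec_intros) simp
  moreover have "foldr a (map list_encode xss) 0 = list_encode (concat xss)" for xss
    by (induction xss) (simp_all add: a(2) del: list_encode_cons)
  ultimately show ?thesis using f(2) that by metis
qed

section \<open>The encoding is computable\<close>

text \<open>Course-of-values recursion on the code: its head is the constructor tag, and the codes
  of the arguments that follow are smaller.\<close>

lemma rec_enc_ty:
  obtains f where "rec1 f" "\<And>a. f (code_ty a) = code_ty (enc_ty a)"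
proof -
  define s where "s x h p =
    (if hd_code x = 2 then
       cons_code 2 (cons_code (lookup x h (hd_code (tl_code x)))
         (cons_code (lookup x h (hd_code (tl_code (tl_code x)))) 0))
     else if hd_code x = 1 then code_ty (enc_ty Prop)
     else code_ty (enc_ty Iota))" for x h p :: nat
  have "rec3 s" unfolding rec3_def s_def by (intro total_rec_intros) simp_all
  then obtain f where f: "rec2 f" "\<And>x p. \<exists>h. (\<forall>y<x. lookup x h y = f y p) \<and> f x p = s x h p"
    by (rule course_of_values) blast
  have "f (code_ty a) 0 = code_ty (enc_ty a)" for a
  proof (induction a)
    case (Fun a b)
    then show ?case using f(2)[of "code_ty (Fun a b)" 0] by (auto simp: s_def cons_code_bounds)
  next
    case Iota
    show ?case using f(2)[of "code_ty Iota" 0] by (auto simp: s_def)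
  next
    case Prop
    show ?case using f(2)[of "code_ty Prop" 0] by (auto simp: s_def)
  qed
  moreover have "rec1 (\<lambda>x. f x 0)"
    unfolding rec1_def by (intro total_rec_comp2[OF f(1)] total_rec_intros) simp
  ultimately show ?thesis using that by blast
qed

lemma rec_enc_tm:
  obtains f where "rec2 f" "\<And>t n. f (code_tm t) n = code_tm (enc_tm n t)"
proof -
  define s where "s x h p =
    (if hd_code x = 3 then
       cons_code 3 (cons_code (lookup x h (hd_code (tl_code x)))
         (cons_code (lookup x h (hd_code (tl_code (tl_code x)))) 0))
     else if hd_code x = 2 then cons_code 1 (cons_code (hd_code (tl_code x) + p) 0)
     else if hd_code x = 1 then cons_code 1 (cons_code (hd_code (tl_code x) + 2) 0)
     else x)" for x h p
  have "rec3 s" unfolding rec3_def s_def by (intro total_rec_intros) simp_all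
  then obtain f where f: "rec2 f" "\<And>x p. \<exists>h. (\<forall>y<x. lookup x h y = f y p) \<and> f x p = s x h p"
    by (rule course_of_values) blast
  have "f (code_tm t) n = code_tm (enc_tm n t)" for t n
  proof (induction t)
    case (App t u)
    then show ?case using f(2)[of "code_tm (App t u)" n] by (auto simp: s_def cons_code_bounds)
  next
    case (Var i)
    show ?case using f(2)[of "code_tm (Var i)" n] by (auto simp: s_def)
  next
    case (Fn c)
    show ?case using f(2)[of "code_tm (Fn c)" n] by (auto simp: s_def)
  next
    case (Pred P)
    show ?case using f(2)[of "code_tm (Pred P)" n] by (auto simp: s_def)
  qed
  with f(1) that show ?thesis by blast
qed

lemma rec_enc_goal:
  obtains f where "rec2 f" "\<And>G n. f (code_goal G) n = code_goal (enc_goal n G)"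
proof -
  obtain ft where ft: "rec1 ft" "\<And>a. ft (code_ty a) = code_ty (enc_ty a)"
    using rec_enc_ty by blast
  obtain fm where fm: "rec2 fm" "\<And>t n. fm (code_tm t) n = code_tm (enc_tm n t)"
    using rec_enc_tm by blast
  note [total_rec_intros] = total_rec_comp1[OF ft(1)] total_rec_comp2[OF fm(1)]
  define s where "s x h p =
    (if hd_code x = 0 then
       cons_code 0 (cons_code (cons_code 3 (cons_code (code_tm (Pred 0))
         (cons_code (cons_code 3 (cons_code (fm (hd_code (tl_code x)) p)
           (cons_code (code_tm (Fn 1)) 0))) 0))) 0)
     else if hd_code x = 1 then
       cons_code 1 (cons_code (lookup x h (hd_code (tl_code x)))
         (cons_code (lookup x h (hd_code (tl_code (tl_code x)))) 0))
     else if hd_code x = 2 then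
       cons_code 2 (cons_code (ft (hd_code (tl_code x)))
         (cons_code (lookup x h (hd_code (tl_code (tl_code x)))) 0))
     else x)" for x h p
  have "rec3 s" unfolding rec3_def s_def by (intro total_rec_intros) simp_all
  then obtain f where f: "rec2 f" "\<And>x p. \<exists>h. (\<forall>y<x. lookup x h y = f y p) \<and> f x p = s x h p"
    by (rule course_of_values) blast
  have "f (code_goal G) n = code_goal (enc_goal n G)" for G n
  proof (induction G)
    case (Atom A)
    show ?case using f(2)[of "code_goal (Atom A)" n] by (auto simp: s_def fm(2))
  next
    case (Conj G H)
    then show ?case using f(2)[of "code_goal (Conj G H)" n] by (auto simp: s_def cons_code_bounds)
  next
    case (Ex a G)
    then show ?case using f(2)[of "code_goal (Ex a G)" n] by (auto simp: s_def ft(2) cons_code_bounds)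
  next
    case Truth
    show ?case using f(2)[of "code_goal Truth" n] by (auto simp: s_def)
  qed
  with f(1) that show ?thesis by blast
qed

lemma rec_enc_tys:
  obtains f where "rec1 f"
    "\<And>as. f (list_encode (map code_ty as)) = list_encode (map code_ty (map enc_ty as))"
proof -
  obtain ft where ft: "rec1 ft" "\<And>a. ft (code_ty a) = code_ty (enc_ty a)"
    using rec_enc_ty by blast
  have "rec2 (\<lambda>x p. ft x)"
    unfolding rec2_def by (intro total_rec_comp1[OF ft(1)] total_rec_intros) simp
  then obtain f where f: "rec2 f" "\<And>xs p. f (list_encode xs) p = list_encode (map ft xs)"
    by (rule rec_map) blast
  have "rec1 (\<lambda>x. f x 0)"
    unfolding rec1_def by (intro total_rec_comp2[OF f(1)] total_rec_intros) simp
  with that show ?thesis by (simp add: f(2) ft(2) comp_def)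
qed

lemma rec_enc_clause:
  obtains f where "rec2 f"
    "\<And>C n. f (code_clause C) n = list_encode (map code_clause (enc_clause n C))"
proof -
  obtain fs where fs: "rec1 fs"
    "\<And>as. fs (list_encode (map code_ty as)) = list_encode (map code_ty (map enc_ty as))"
    using rec_enc_tys by blast
  obtain fm where fm: "rec2 fm" "\<And>t n. fm (code_tm t) n = code_tm (enc_tm n t)"
    using rec_enc_tm by blast
  obtain fg where fg: "rec2 fg" "\<And>G n. fg (code_goal G) n = code_goal (enc_goal n G)"
    using rec_enc_goal by blast
  obtain a where a: "rec2 a"
    "\<And>xs ys. a (list_encode xs) (list_encode ys) = list_encode (xs @ ys)" using rec_append by blast
  obtain l where l: "rec1 l" "\<And>xs. l (list_encode xs) = length xs" using rec_length by blast
  note [total_rec_intros] = total_rec_comp1[OF fs(1)] total_rec_comp2[OF fm(1)]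
    total_rec_comp2[OF fg(1)] total_rec_comp2[OF a(1)] total_rec_comp1[OF l(1)]
  have a1: "a (list_encode xs) (cons_code y 0) = list_encode (xs @ [y])" for xs y
    using a(2)[of xs "[y]"] by simp
  \<comment> \<open>Common shape of \<open>truth_clause\<close> and \<open>constr_clause\<close>:
    \<open>b\<close> is the type of the dummy, \<open>P\<close> the index of the head predicate and
    \<open>t\<close> the code of the term that receives the dummy.\<close>
  define gen where "gen ss G P t b n =
    cons_code (a (fs ss) (cons_code b 0)) (cons_code (fg G n) (cons_code
      (cons_code 3 (cons_code (cons_code 2 (cons_code P 0)) (cons_code
        (cons_code 3 (cons_code (fm t n) (cons_code (cons_code 0 (cons_code (l ss) 0)) 0))) 0)))
      0))" for ss G P t b n
  define truth where "truth x n =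
    cons_code (gen (hd_code x) (hd_code (tl_code x)) 0 (hd_code (tl_code (tl_code x)))
      (code_ty tok_ty) n) 0" for x n
  define constr where "constr x n =
    (let A = hd_code (tl_code (tl_code x)) in
     gen (hd_code x) (hd_code (tl_code x)) (Suc (hd_code (tl_code (hd_code (tl_code A)))))
       (hd_code (tl_code (tl_code A))) (code_ty Iota) n)" for x n
  define bridge where "bridge P n =
    cons_code (list_encode (map code_ty [Fun Iota Iota, tok_ty])) (cons_code
      (cons_code 0 (cons_code (cons_code 3 (cons_code (cons_code 2 (cons_code (Suc P) 0))
        (cons_code (code_tm (App (Var 0) (Fn 0))) 0))) 0))
      (cons_code
        (cons_code 3 (cons_code (code_tm (Pred 0)) (cons_code
          (cons_code 3 (cons_code
            (cons_code 3 (cons_code (cons_code 1 (cons_code (P + n) 0))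
              (cons_code (code_tm (Var 0)) 0)))
            (cons_code (code_tm (Var 1)) 0))) 0))) 0))" for P n
  \<comment> \<open>The tags 3, 2 and 0 recognise \<open>App\<close>, \<open>Pred\<close> and
    \<open>Var\<close>, following the case distinction of \<open>enc_clause\<close>.\<close>
  define f where "f x n =
    (let A = hd_code (tl_code (tl_code x)) in
     if hd_code A = 3 then
       if hd_code (hd_code (tl_code A)) = 2 then
         if hd_code (hd_code (tl_code (tl_code A))) = 0 then truth x n
         else cons_code (constr x n)
           (cons_code (bridge (hd_code (tl_code (hd_code (tl_code A)))) n) 0)
       else truth x n
     else truth x n)" for x n
  have r: "rec2 truth" "rec2 constr" "rec2 bridge"
    unfolding rec2_def truth_def constr_def bridge_def gen_def Let_def
    by (intro total_rec_intros; simp)+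
  note [total_rec_intros] = total_rec_comp2[OF r(1)] total_rec_comp2[OF r(2)] total_rec_comp2[OF r(3)]
  have "rec2 f" unfolding rec2_def f_def Let_def by (intro total_rec_intros; simp)
  moreover have "f (code_clause C) n = list_encode (map code_clause (enc_clause n C))" for C n
  proof (cases C)
    case (Clause ss G A)
    have t: "truth (code_clause C) n = list_encode [code_clause (truth_clause n ss G A)]"
      by (simp add: Clause truth_def gen_def truth_clause_def fs(2) fm(2) fg(2) a1 l(2))
    have c: "constr (code_clause C) n = code_clause (constr_clause n ss G P X)"
      if "A = App (Pred P) X" for P X
      by (simp add: Clause that constr_def gen_def constr_clause_def fs(2) fm(2) fg(2) a1 l(2))
    have b: "bridge P n = code_clause (bridge_clause n P)" for P
      by (simp add: bridge_def bridge_clause_def)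
    show ?thesis
    proof (cases "\<exists>P X. A = App (Pred P) X \<and> (\<forall>i. X \<noteq> Var i)")
      case True
      then obtain P X where A: "A = App (Pred P) X" "\<forall>i. X \<noteq> Var i" by blast
      from A(2) have hX: "hd_code (code_tm X) \<noteq> 0" by (cases X) simp_all
      have "enc_clause n C = [constr_clause n ss G P X, bridge_clause n P]"
        using A by (auto simp: Clause split: tm.split)
      moreover have "f (code_clause C) n =
          cons_code (constr (code_clause C) n) (cons_code (bridge P n) 0)"
        using hX by (simp add: f_def Clause A(1))
      ultimately show ?thesis using c[OF A(1)] b by simp
    next
      case False
      then have "enc_clause n C = [truth_clause n ss G A]"
        by (auto simp: Clause split: tm.split)
      moreover have "f (code_clause C) n = truth (code_clause C) n"
      proof (cases A)
        case (App s X)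
        show ?thesis
        proof (cases s)
          case (Pred P)
          with App False obtain i where "X = Var i" by blast
          with App Pred show ?thesis by (simp add: f_def Clause)
        qed (simp_all add: f_def Clause App)
      qed (simp_all add: f_def Clause)
      ultimately show ?thesis using t by simp
    qed
  qed
  ultimately show ?thesis using that by blast
qed

text \<open>The encoding branches on syntax only, so one program serves every set \<open>X\<close>.
  It computes the offset from the length of the coded function signature.\<close>

lemma computable_enc_problem: "computable_on X enc_problem"
proof -
  obtain fs where fs: "rec1 fs"
    "\<And>as. fs (list_encode (map code_ty as)) = list_encode (map code_ty (map enc_ty as))"
    using rec_enc_tys by blast
  obtain fg where fg: "rec2 fg" "\<And>G n. fg (code_goal G) n = code_goal (enc_goal n G)"
    using rec_enc_goal by blast
  obtain fc where fc: "rec2 fc"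
    "\<And>C n. fc (code_clause C) n = list_encode (map code_clause (enc_clause n C))"
    using rec_enc_clause by blast
  obtain fcs where fcs: "rec2 fcs"
    "\<And>xs n. fcs (list_encode xs) n = list_encode (map (\<lambda>x. fc x n) xs)"
    using rec_map[OF fc(1)] by blast
  obtain cc where cc: "rec1 cc"
    "\<And>xss. cc (list_encode (map list_encode xss)) = list_encode (concat xss)"
    using rec_concat by blast
  have "rec2 (\<lambda>x p. code_ty (Fun Iota Prop))" unfolding rec2_def by (intro total_rec_intros)
  then obtain k where k: "rec2 k"
    "\<And>xs p. k (list_encode xs) p = list_encode (map (\<lambda>x. code_ty (Fun Iota Prop)) xs)"
    by (rule rec_map) blast
  obtain a where a: "rec2 a"
    "\<And>xs ys. a (list_encode xs) (list_encode ys) = list_encode (xs @ ys)" using rec_append by blast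
  obtain l where l: "rec1 l" "\<And>xs. l (list_encode xs) = length xs" using rec_length by blast
  note [total_rec_intros] = total_rec_comp1[OF fs(1)] total_rec_comp2[OF fcs(1)]
    total_rec_comp2[OF fg(1)] total_rec_comp2[OF a(1)] total_rec_comp1[OF l(1)]
    total_rec_comp1[OF cc(1)] total_rec_comp2[OF k(1)]
  define f where "f x =
    cons_code (cons_code (code_ty Iota) (cons_code (code_ty tok_ty)
      (a (fs (hd_code x)) (fs (hd_code (tl_code x))))))
    (cons_code (cons_code (code_ty (Fun Iota Prop)) (k (hd_code (tl_code x)) 0))
    (cons_code (cc (fcs (hd_code (tl_code (tl_code x))) (l (hd_code x) + 2)))
    (cons_code (fg (hd_code (tl_code (tl_code (tl_code x)))) (l (hd_code x) + 2)) 0)))" for x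
  have clauses: "cc (fcs (list_encode (map code_clause D)) n)
      = list_encode (map code_clause (concat (map (enc_clause n) D)))" for D n
    using cc(2)[of "map (\<lambda>C. map code_clause (enc_clause n C)) D"]
    by (simp add: fcs(2) fc(2) map_concat comp_def)
  have "f (code_problem I) = code_problem (enc_problem I)" for I
    by (cases I)
      (simp add: f_def enc_fns_def enc_preds_def fs(2) fg(2) a(2) l(2) k(2) clauses comp_def
        del: code_ty.simps)
  moreover have "rec1 f" unfolding rec1_def f_def by (intro total_rec_intros) simp_all
  then obtain r where "\<And>xs. length xs = 1 \<Longrightarrow> rec_val r xs = Some (f (xs ! 0))"
    unfolding rec1_def total_rec_def by blast
  ultimately show ?thesis unfolding computable_on_def by (intro exI[of _ r]) simp
qed

theorem theorem3p1:
  "\<exists>f :: problem \<Rightarrow> problem.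
     computable_on {I. homsl_instance I} f \<and>
     (\<forall>I. homsl_instance I \<longrightarrow> msl_instance (f I) \<and> (provable I \<longleftrightarrow> provable (f I))) \<and>
     (\<forall>I J. homsl_instance I \<longrightarrow> homsl_instance J \<longrightarrow> problem_eq I J \<longrightarrow>
        problem_eq (f I) (f J))"
  using computable_enc_problem msl_instance_enc_problem provable_enc_problem problem_eq_enc by blast

end
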